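(* Let $U \in U'$ be Grothendieck universes. Then there is a unique $U'$-small category $\Omega$ whose objects, hom sets, composition and identity arrows are as follows (in particular the composition below is well defined, associative, and has the given arrows as two-sided identities). (1) Objects are pairs $(C,x)$ with $C$ a $U$-small category and $x$ an object of $C$. (2) $\mathrm{Hom}_{\Omega}((C,x),(D,y))$ is the set of equivalence classes $[(F,\phi)]$ of pairs consisting of a functor $F : C^{op}\times D \to U\text{-}\mathbf{Set}$ and an element $\phi \in F(x,y)$, where $(F,\phi)\equiv (G,\psi)$ iff there is a natural isomorphism $\Phi : F \to G$ with $\Phi(x,y)(\phi)=\psi$. (3) For $[(F,\phi)] : (C,x)\to (D,y)$ and $[(G,\psi)] : (D,y)\to (E,z)$, the composite is $$[(G,\psi)]\circ[(F,\phi)] := [(F *_{\Omega} G,\ [(\phi,\psi)])],$$ where $F*_{\Omega}G : C^{op}\times E\to U\text{-}\mathbf{Set}$ sends $(x',z')$ to the quotient of $\coprod_{y'\in Ob(D)} F(x',y')\times G(y',z')$ by the equivalence relation $R'(F,G,x',z')$. (4) The identity of $(C,x)$ is $[(\mathrm{Hom}_C,\mathrm{id}_x)]$.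
   Context: For functors $F : C^{op}\times D\to U\text{-}\mathbf{Set}$ and $G : D^{op}\times E\to U\text{-}\mathbf{Set}$, and objects $x$ of $C$, $z$ of $E$, the relation $R'(F,G,x,z)$ on $\coprod_{y\in Ob(D)}F(x,y)\times G(y,z)$ is the equivalence relation generated by the following: $(\phi,\psi)\in F(x,y)\times G(y,z)$ is related to $(\phi',\psi')\in F(x,y')\times G(y',z)$ whenever there is an arrow $f : y\to y'$ in $D$ with $G(f,\mathrm{id}_z)(\psi')=\psi$ and $F(\mathrm{id}_x,f)(\phi)=\phi'$. The functor $F*_\Omega G$ acts on arrows in the evident way, through $F$ in the first variable and $G$ in the second. A category is $U$-small if its sets of objects and of arrows are elements of $U$; $U\text{-}\mathbf{Set}$ is the category of sets belonging to $U$. Formally, elements of hom sets are tagged with their domain and codomain so that distinct hom sets are disjoint. *)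

theory Defs
  imports Main
begin

text \<open>
  The ambient set theory. A type of class \<open>zfc\<close> is a universe of sets satisfying the axioms of
  Zermelo-Fraenkel set theory; \<open>elts x\<close> is the extension of the set \<open>x\<close>, so \<open>y \<in> elts x\<close> is
  membership. Separation and replacement range over all predicates and functions of the logic.
  The axiom of choice is not listed because it follows from these two together with the choice
  operator of the logic.
\<close>

class zfc =
  fixes elts :: "'a \<Rightarrow> 'a set"
  assumes extensionality: "elts x = elts y \<Longrightarrow> x = y"
    and foundation: "elts x \<noteq> {} \<Longrightarrow> \<exists>y\<in>elts x. elts y \<inter> elts x = {}"
    and separation: "\<exists>y. elts y = {u \<in> elts x. P u}"
    and replacement: "\<exists>y. elts y = f ` elts x"
    and pairing: "\<exists>z. elts z = {x, y}"
    and union: "\<exists>y. elts y = (\<Union>u\<in>elts x. elts u)"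
    and power_set: "\<exists>y. elts y = {z. elts z \<subseteq> elts x}"
    and infinity: "\<exists>w. (\<exists>e\<in>elts w. elts e = {}) \<and>
                       (\<forall>u\<in>elts w. \<exists>v\<in>elts w. elts v = insert u (elts u))"

text \<open>The set with extension \<open>A\<close>; meaningful only if \<open>A\<close> is not a proper class.\<close>

definition vset :: "'v::zfc set \<Rightarrow> 'v"
  where "vset A = (THE x. elts x = A)"

definition vpair :: "'v::zfc \<Rightarrow> 'v \<Rightarrow> 'v"
  where "vpair x y = vset {vset {x}, vset {x, y}}"

definition vfst :: "'v::zfc \<Rightarrow> 'v"
  where "vfst p = (THE x. \<exists>y. p = vpair x y)"

definition vsnd :: "'v::zfc \<Rightarrow> 'v"
  where "vsnd p = (THE y. \<exists>x. p = vpair x y)"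

definition vtimes :: "'v::zfc \<Rightarrow> 'v \<Rightarrow> 'v"
  where "vtimes A B = vset {vpair a b | a b. a \<in> elts A \<and> b \<in> elts B}"

text \<open>Set-theoretic functions are their graphs.\<close>

definition vlambda :: "'v::zfc \<Rightarrow> ('v \<Rightarrow> 'v) \<Rightarrow> 'v"
  where "vlambda A h = vset {vpair a (h a) | a. a \<in> elts A}"

definition app :: "'v::zfc \<Rightarrow> 'v \<Rightarrow> 'v"
  where "app f a = (THE b. vpair a b \<in> elts f)"

definition vfuns :: "'v::zfc \<Rightarrow> 'v \<Rightarrow> 'v set"
  where "vfuns A B = {f. elts f \<subseteq> elts (vtimes A B) \<and> (\<forall>a\<in>elts A. \<exists>!b. vpair a b \<in> elts f)}"

definition vquot :: "'v::zfc \<Rightarrow> ('v \<times> 'v) set \<Rightarrow> 'v"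
  where "vquot A R = vset (vset ` (elts A // R))"

definition vclass :: "('v::zfc \<times> 'v) set \<Rightarrow> 'v \<Rightarrow> 'v"
  where "vclass R p = vset (R `` {p})"

definition grothendieck_universe :: "'v::zfc \<Rightarrow> bool"
  where "grothendieck_universe U \<longleftrightarrow>
    elts U \<noteq> {} \<and>
    (\<forall>x\<in>elts U. elts x \<subseteq> elts U) \<and>
    (\<forall>x\<in>elts U. \<forall>y\<in>elts U. vset {x, y} \<in> elts U) \<and>
    (\<forall>x\<in>elts U. vset {z. elts z \<subseteq> elts x} \<in> elts U) \<and>
    (\<forall>I\<in>elts U. \<forall>X. (\<forall>i\<in>elts I. X i \<in> elts U) \<longrightarrow> vset (\<Union>i\<in>elts I. elts (X i)) \<in> elts U)"


text \<open>
  A category is a set: the tuple of its set of objects, its set of arrows, and the domain, codomain,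
  identity and composition functions, the last one defined on the set of composable pairs.
  \<open>mk_cat\<close> forms such a tuple from operations of the logic; \<open>ccomp C g f\<close> is \<open>g\<close> after \<open>f\<close>.
\<close>

definition mk_cat ::
    "'v::zfc \<Rightarrow> 'v \<Rightarrow> ('v \<Rightarrow> 'v) \<Rightarrow> ('v \<Rightarrow> 'v) \<Rightarrow> ('v \<Rightarrow> 'v) \<Rightarrow> ('v \<Rightarrow> 'v \<Rightarrow> 'v) \<Rightarrow> 'v"
  where "mk_cat Obj A d c i m =
    vpair Obj (vpair A (vpair (vlambda A d) (vpair (vlambda A c) (vpair (vlambda Obj i)
      (vlambda (vset {vpair g f | g f. g \<in> elts A \<and> f \<in> elts A \<and> d g = c f})
        (\<lambda>p. m (vfst p) (vsnd p)))))))"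

definition Ob :: "'v::zfc \<Rightarrow> 'v"
  where "Ob C = vfst C"

definition Arr :: "'v::zfc \<Rightarrow> 'v"
  where "Arr C = vfst (vsnd C)"

definition cdom :: "'v::zfc \<Rightarrow> 'v \<Rightarrow> 'v"
  where "cdom C f = app (vfst (vsnd (vsnd C))) f"

definition ccod :: "'v::zfc \<Rightarrow> 'v \<Rightarrow> 'v"
  where "ccod C f = app (vfst (vsnd (vsnd (vsnd C)))) f"

definition cid :: "'v::zfc \<Rightarrow> 'v \<Rightarrow> 'v"
  where "cid C x = app (vfst (vsnd (vsnd (vsnd (vsnd C))))) x"

definition ccomp :: "'v::zfc \<Rightarrow> 'v \<Rightarrow> 'v \<Rightarrow> 'v"
  where "ccomp C g f = app (vsnd (vsnd (vsnd (vsnd (vsnd C))))) (vpair g f)"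

definition chom :: "'v::zfc \<Rightarrow> 'v \<Rightarrow> 'v \<Rightarrow> 'v set"
  where "chom C x y = {f \<in> elts (Arr C). cdom C f = x \<and> ccod C f = y}"

text \<open>
  The first conjunct says that \<open>C\<close> is a tuple of the required shape, whose last four components are
  functions with exactly the required domains (so that a category is determined by its objects,
  arrows and operations).
\<close>

definition is_category :: "'v::zfc \<Rightarrow> bool"
  where "is_category C \<longleftrightarrow>
    C = mk_cat (Ob C) (Arr C) (cdom C) (ccod C) (cid C) (ccomp C) \<and>
    (\<forall>f\<in>elts (Arr C). cdom C f \<in> elts (Ob C) \<and> ccod C f \<in> elts (Ob C)) \<and>
    (\<forall>x\<in>elts (Ob C). cid C x \<in> chom C x x) \<and>
    (\<forall>x y z f g. f \<in> chom C x y \<longrightarrow> g \<in> chom C y z \<longrightarrow> ccomp C g f \<in> chom C x z) \<and>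
    (\<forall>x y f. f \<in> chom C x y \<longrightarrow> ccomp C f (cid C x) = f \<and> ccomp C (cid C y) f = f) \<and>
    (\<forall>w x y z f g h. f \<in> chom C w x \<longrightarrow> g \<in> chom C x y \<longrightarrow> h \<in> chom C y z \<longrightarrow>
       ccomp C h (ccomp C g f) = ccomp C (ccomp C h g) f)"

definition small_category :: "'v::zfc \<Rightarrow> 'v \<Rightarrow> bool"
  where "small_category U C \<longleftrightarrow> is_category C \<and> Ob C \<in> elts U \<and> Arr C \<in> elts U"

definition op_cat :: "'v::zfc \<Rightarrow> 'v"
  where "op_cat C = mk_cat (Ob C) (Arr C) (ccod C) (cdom C) (cid C) (\<lambda>g f. ccomp C f g)"

definition prod_cat :: "'v::zfc \<Rightarrow> 'v \<Rightarrow> 'v"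
  where "prod_cat C D =
    mk_cat (vtimes (Ob C) (Ob D)) (vtimes (Arr C) (Arr D))
      (\<lambda>p. vpair (cdom C (vfst p)) (cdom D (vsnd p)))
      (\<lambda>p. vpair (ccod C (vfst p)) (ccod D (vsnd p)))
      (\<lambda>a. vpair (cid C (vfst a)) (cid D (vsnd a)))
      (\<lambda>q p. vpair (ccomp C (vfst q) (vfst p)) (ccomp D (vsnd q) (vsnd p)))"

text \<open>Arrows of the category of sets are triples \<open>(A, B, h)\<close> with \<open>h\<close> a function from \<open>A\<close> to \<open>B\<close>.\<close>

definition set_arr :: "'v::zfc \<Rightarrow> 'v \<Rightarrow> 'v \<Rightarrow> 'v"
  where "set_arr A B h = vpair A (vpair B h)"

definition set_map :: "'v::zfc \<Rightarrow> 'v"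
  where "set_map t = vsnd (vsnd t)"

definition set_cat :: "'v::zfc \<Rightarrow> 'v"
  where "set_cat U =
    mk_cat U (vset {set_arr A B h | A B h. A \<in> elts U \<and> B \<in> elts U \<and> h \<in> vfuns A B})
      vfst
      (\<lambda>t. vfst (vsnd t))
      (\<lambda>A. set_arr A A (vlambda A (\<lambda>a. a)))
      (\<lambda>t s. set_arr (vfst s) (vfst (vsnd t))
               (vlambda (vfst s) (\<lambda>a. app (set_map t) (app (set_map s) a))))"

text \<open>A functor is the pair of its object function and its arrow function.\<close>

definition mk_functor :: "'v::zfc \<Rightarrow> ('v \<Rightarrow> 'v) \<Rightarrow> ('v \<Rightarrow> 'v) \<Rightarrow> 'v"
  where "mk_functor C ob ar = vpair (vlambda (Ob C) ob) (vlambda (Arr C) ar)"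

definition fobj :: "'v::zfc \<Rightarrow> 'v \<Rightarrow> 'v"
  where "fobj F x = app (vfst F) x"

definition farr :: "'v::zfc \<Rightarrow> 'v \<Rightarrow> 'v"
  where "farr F f = app (vsnd F) f"

definition is_functor :: "'v::zfc \<Rightarrow> 'v \<Rightarrow> 'v \<Rightarrow> bool"
  where "is_functor C D F \<longleftrightarrow>
    F = mk_functor C (fobj F) (farr F) \<and>
    (\<forall>x\<in>elts (Ob C). fobj F x \<in> elts (Ob D)) \<and>
    (\<forall>x y f. f \<in> chom C x y \<longrightarrow> farr F f \<in> chom D (fobj F x) (fobj F y)) \<and>
    (\<forall>x\<in>elts (Ob C). farr F (cid C x) = cid D (fobj F x)) \<and>
    (\<forall>x y z f g. f \<in> chom C x y \<longrightarrow> g \<in> chom C y z \<longrightarrow>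
       farr F (ccomp C g f) = ccomp D (farr F g) (farr F f))"

definition is_nat_trans :: "'v::zfc \<Rightarrow> 'v \<Rightarrow> 'v \<Rightarrow> 'v \<Rightarrow> 'v \<Rightarrow> bool"
  where "is_nat_trans C D F G N \<longleftrightarrow>
    is_functor C D F \<and> is_functor C D G \<and>
    N = vlambda (Ob C) (app N) \<and>
    (\<forall>x\<in>elts (Ob C). app N x \<in> chom D (fobj F x) (fobj G x)) \<and>
    (\<forall>x y f. f \<in> chom C x y \<longrightarrow>
       ccomp D (app N y) (farr F f) = ccomp D (farr G f) (app N x))"

definition is_iso :: "'v::zfc \<Rightarrow> 'v \<Rightarrow> bool"
  where "is_iso C f \<longleftrightarrow>
    (\<exists>x y g. f \<in> chom C x y \<and> g \<in> chom C y x \<and> ccomp C g f = cid C x \<and> ccomp C f g = cid C y)"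

definition is_nat_iso :: "'v::zfc \<Rightarrow> 'v \<Rightarrow> 'v \<Rightarrow> 'v \<Rightarrow> 'v \<Rightarrow> bool"
  where "is_nat_iso C D F G N \<longleftrightarrow>
    is_nat_trans C D F G N \<and> (\<forall>x\<in>elts (Ob C). is_iso D (app N x))"


text \<open>
  Functors \<open>F : C\<^sup>o\<^sup>p \<times> D \<rightarrow> U-Set\<close>: \<open>pobj F x y\<close> is \<open>F(x, y)\<close>, and \<open>pact F f g a\<close> is \<open>F(f, g)(a)\<close>.
\<close>

definition is_prof :: "'v::zfc \<Rightarrow> 'v \<Rightarrow> 'v \<Rightarrow> 'v \<Rightarrow> bool"
  where "is_prof U C D F \<longleftrightarrow> is_functor (prod_cat (op_cat C) D) (set_cat U) F"

definition pobj :: "'v::zfc \<Rightarrow> 'v \<Rightarrow> 'v \<Rightarrow> 'v"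
  where "pobj F x y = fobj F (vpair x y)"

definition pact :: "'v::zfc \<Rightarrow> 'v \<Rightarrow> 'v \<Rightarrow> 'v \<Rightarrow> 'v"
  where "pact F f g a = app (set_map (farr F (vpair f g))) a"

definition hom_functor :: "'v::zfc \<Rightarrow> 'v"
  where "hom_functor C =
    mk_functor (prod_cat (op_cat C) C)
      (\<lambda>a. vset (chom C (vfst a) (vsnd a)))
      (\<lambda>p. let f = vfst p; g = vsnd p;
               A = vset (chom C (ccod C f) (cdom C g));
               B = vset (chom C (cdom C f) (ccod C g))
           in set_arr A B (vlambda A (\<lambda>h. ccomp C g (ccomp C h f))))"

text \<open>The disjoint union over \<open>y\<close> of \<open>F(x, y) \<times> G(y, z)\<close>; its elements are triples \<open>(y, \<phi>, \<psi>)\<close>.\<close>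

definition coprod :: "'v::zfc \<Rightarrow> 'v \<Rightarrow> 'v \<Rightarrow> 'v \<Rightarrow> 'v \<Rightarrow> 'v"
  where "coprod D F G x z =
    vset {vpair y (vpair \<phi> \<psi>) | y \<phi> \<psi>.
            y \<in> elts (Ob D) \<and> \<phi> \<in> elts (pobj F x y) \<and> \<psi> \<in> elts (pobj G y z)}"

definition R'_gen :: "'v::zfc \<Rightarrow> 'v \<Rightarrow> 'v \<Rightarrow> 'v \<Rightarrow> 'v \<Rightarrow> 'v \<Rightarrow> 'v \<Rightarrow> 'v \<Rightarrow> 'v \<Rightarrow> bool"
  where "R'_gen C D E F G x z p p' \<longleftrightarrow>
    p \<in> elts (coprod D F G x z) \<and> p' \<in> elts (coprod D F G x z) \<and>
    (\<exists>y \<phi> \<psi> y' \<phi>' \<psi>' f.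
       p = vpair y (vpair \<phi> \<psi>) \<and> p' = vpair y' (vpair \<phi>' \<psi>') \<and>
       f \<in> chom D y y' \<and> pact G f (cid E z) \<psi>' = \<psi> \<and> pact F (cid C x) f \<phi> = \<phi>')"

definition R' :: "'v::zfc \<Rightarrow> 'v \<Rightarrow> 'v \<Rightarrow> 'v \<Rightarrow> 'v \<Rightarrow> 'v \<Rightarrow> 'v \<Rightarrow> ('v \<times> 'v) set"
  where "R' C D E F G x z =
    {(p, q). p \<in> elts (coprod D F G x z) \<and> q \<in> elts (coprod D F G x z) \<and>
             equivclp (R'_gen C D E F G x z) p q}"

definition tensor_class :: "'v::zfc \<Rightarrow> 'v \<Rightarrow> 'v \<Rightarrow> 'v \<Rightarrow> 'v \<Rightarrow> 'v \<Rightarrow> 'v \<Rightarrow> 'v \<Rightarrow> 'v \<Rightarrow> 'v \<Rightarrow> 'v"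
  where "tensor_class C D E F G x z y \<phi> \<psi> = vclass (R' C D E F G x z) (vpair y (vpair \<phi> \<psi>))"

definition tensor_obj :: "'v::zfc \<Rightarrow> 'v \<Rightarrow> 'v \<Rightarrow> 'v \<Rightarrow> 'v \<Rightarrow> 'v \<Rightarrow> 'v \<Rightarrow> 'v"
  where "tensor_obj C D E F G x z = vquot (coprod D F G x z) (R' C D E F G x z)"

text \<open>
  The functor \<open>F *\<^sub>\<Omega> G\<close>. An arrow \<open>(f, h)\<close> with \<open>f : x' \<rightarrow> x\<close> in \<open>C\<close> and \<open>h : z \<rightarrow> z'\<close> in \<open>E\<close> sends the
  class of \<open>(y, \<phi>, \<psi>)\<close> over \<open>(x, z)\<close> to the class of \<open>(y, F(f, id\<^sub>y)(\<phi>), G(id\<^sub>y, h)(\<psi>))\<close> over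
  \<open>(x', z')\<close>. This assignment is written as a graph.
\<close>

definition tensor :: "'v::zfc \<Rightarrow> 'v \<Rightarrow> 'v \<Rightarrow> 'v \<Rightarrow> 'v \<Rightarrow> 'v"
  where "tensor C D E F G =
    mk_functor (prod_cat (op_cat C) E)
      (\<lambda>a. tensor_obj C D E F G (vfst a) (vsnd a))
      (\<lambda>p. let f = vfst p; h = vsnd p;
               x = ccod C f; x' = cdom C f; z = cdom E h; z' = ccod E h
           in set_arr (tensor_obj C D E F G x z) (tensor_obj C D E F G x' z')
                (vset {vpair (tensor_class C D E F G x z y \<phi> \<psi>)
                             (tensor_class C D E F G x' z' y
                                (pact F f (cid D y) \<phi>) (pact G (cid D y) h \<psi>)) | y \<phi> \<psi>.
                         vpair y (vpair \<phi> \<psi>) \<in> elts (coprod D F G x z)}))"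

text \<open>
  The relation \<open>(F, \<phi>) \<equiv> (G, \<psi>)\<close> for \<open>\<phi> \<in> F(x, y)\<close> and \<open>\<psi> \<in> G(x, y)\<close>.
\<close>

definition pointed_iso :: "'v::zfc \<Rightarrow> 'v \<Rightarrow> 'v \<Rightarrow> 'v \<Rightarrow> 'v \<Rightarrow> ('v \<times> 'v) set"
  where "pointed_iso U C x D y =
    {(vpair F \<phi>, vpair G \<psi>) | F \<phi> G \<psi>.
       is_prof U C D F \<and> \<phi> \<in> elts (pobj F x y) \<and> is_prof U C D G \<and> \<psi> \<in> elts (pobj G x y) \<and>
       (\<exists>N. is_nat_iso (prod_cat (op_cat C) D) (set_cat U) F G N \<and>
            app (set_map (app N (vpair x y))) \<phi> = \<psi>)}"

text \<open>The class \<open>[(F, \<phi>)]\<close>, tagged with its domain \<open>(C, x)\<close> and its codomain \<open>(D, y)\<close>.\<close>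

definition Omega_arr :: "'v::zfc \<Rightarrow> 'v \<Rightarrow> 'v \<Rightarrow> 'v \<Rightarrow> 'v \<Rightarrow> 'v \<Rightarrow> 'v \<Rightarrow> 'v"
  where "Omega_arr U C x D y F \<phi> =
    vpair (vpair C x) (vpair (vpair D y) (vclass (pointed_iso U C x D y) (vpair F \<phi>)))"

end

theory Submission
  imports Defs
begin

text \<open>
  \<open>\<Omega>\<close> is the bicategory of categories and profunctors, with points added and with the 2-dimensional
  structure divided out. In the bicategory composition is associative and unital only up to natural
  isomorphism. These isomorphisms carry the distinguished points to each other, so after passage
  to isomorphism classes of pointed profunctors the laws hold strictly.

  A functor \<open>F : C\<^sup>o\<^sup>p \<times> D \<rightarrow> U-Set\<close> is handled as a family of sets with a two-sided action
  (\<open>pact_id\<close>, \<open>pact_comp\<close>, and conversely \<open>prof_mk_functor\<close>), and a natural isomorphism as a natural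
  family of bijections (\<open>prof_iso\<close>). The elements of a composite are classes \<open>[\<phi>, \<psi>]\<close> subject to
  the sliding rule \<open>cls_slide\<close>, as for a tensor product of bimodules. A map out of a composite is
  therefore a map on pairs that respects sliding, and \<open>tensor_isoI\<close> says when such a map is a
  natural isomorphism. It yields the four facts on which the category rests: composition respects
  isomorphism (\<open>tensor_cong\<close>), it is associative (\<open>tensor_assoc\<close>), and the hom functor is a left
  and a right unit, which is the co-Yoneda lemma (\<open>tensor_unit_left\<close>, \<open>tensor_unit_right\<close>). The
  values on classes given by these lemmas show that the points match.

  For the size conditions, a functor from a \<open>U\<close>-small category to the category of sets of \<open>U\<close>
  is an element of \<open>U\<close>, so an isomorphism class is a subset of \<open>U\<close>. Arrows of \<open>\<Omega>\<close> are then elements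
  of \<open>U \<times> (U \<times> P(U))\<close>, which belongs to \<open>U'\<close>. Uniqueness holds because a category is a tuple
  that is determined by its objects, hom sets, identities and composites (\<open>category_eqI\<close>).
\<close>

section \<open>Sets, pairs and functions\<close>

definition small :: "'v::zfc set \<Rightarrow> bool"
  where "small A \<longleftrightarrow> (\<exists>x. elts x = A)"

lemma elts_inject: "elts x = elts y \<longleftrightarrow> x = y"
  using extensionality by blast

lemma vset_elts [simp]: "vset (elts x) = x"
  unfolding vset_def by (rule the_equality) (auto simp: elts_inject)

lemma elts_vset: "small A \<Longrightarrow> elts (vset A) = A"
  unfolding small_def by auto

lemma small_elts [simp]: "small (elts x)"
  unfolding small_def by blast

lemma small_subset: "small B \<Longrightarrow> A \<subseteq> B \<Longrightarrow> small A"
proof -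
  assume "small B" and AB: "A \<subseteq> B"
  then obtain x where x: "elts x = B" unfolding small_def by blast
  obtain y where "elts y = {u \<in> elts x. u \<in> A}" using separation[of x "\<lambda>u. u \<in> A"] by blast
  then have "elts y = A" using x AB by auto
  then show ?thesis unfolding small_def by blast
qed

lemma small_image:
  fixes f :: "'v::zfc \<Rightarrow> 'v"
  shows "small A \<Longrightarrow> small (f ` A)"
  unfolding small_def using replacement[where f = f] by metis

lemma small_pair [simp]: "small {x, y}"
  unfolding small_def using pairing by metis

lemma small_singleton [simp]: "small {x}"
  using small_pair[of x x] by simp

lemma small_UN:
  fixes A :: "'v::zfc set" and B :: "'v \<Rightarrow> 'v set"
  assumes "small A" and "\<And>a. a \<in> A \<Longrightarrow> small (B a)"
  shows "small (\<Union>a\<in>A. B a)"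
proof -
  obtain x where x: "elts x = (\<lambda>a. vset (B a)) ` A"
    using small_image[OF assms(1)] unfolding small_def by blast
  obtain y where "elts y = (\<Union>u\<in>elts x. elts u)" using union by blast
  then have "elts y = (\<Union>a\<in>A. B a)"
    using assms(2) by (simp add: x elts_vset)
  then show ?thesis unfolding small_def by blast
qed

lemma small_image2:
  fixes h :: "'v::zfc \<Rightarrow> 'v \<Rightarrow> 'v"
  shows "small A \<Longrightarrow> small B \<Longrightarrow> small {h a b | a b. a \<in> A \<and> b \<in> B}"
proof -
  assume "small A" "small B"
  then have "small (\<Union>a\<in>A. h a ` B)" by (intro small_UN small_image)
  then show ?thesis by (rule small_subset) blast
qed

lemma small_Pow: "small {z. elts z \<subseteq> elts x}"
  unfolding small_def using power_set by blast

lemma vset_inject: "small A \<Longrightarrow> small B \<Longrightarrow> vset A = vset B \<longleftrightarrow> A = B"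
  using elts_vset by metis

lemma vpair_inject [simp]: "vpair x y = vpair x' y' \<longleftrightarrow> x = x' \<and> y = y'"
  by (auto simp: vpair_def vset_inject doubleton_eq_iff)

lemma vfst_vpair [simp]: "vfst (vpair x y) = x"
  unfolding vfst_def by simp

lemma vsnd_vpair [simp]: "vsnd (vpair x y) = y"
  unfolding vsnd_def by simp

lemma elts_vtimes: "elts (vtimes A B) = {vpair a b | a b. a \<in> elts A \<and> b \<in> elts B}"
  unfolding vtimes_def by (intro elts_vset small_image2 small_elts)

lemma elts_vlambda: "elts (vlambda A h) = {vpair a (h a) | a. a \<in> elts A}"
proof -
  have "small ((\<lambda>a. vpair a (h a)) ` elts A)" by (intro small_image small_elts)
  then have "small {vpair a (h a) | a. a \<in> elts A}" by (rule small_subset) blast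
  then show ?thesis unfolding vlambda_def by (rule elts_vset)
qed

lemma app_vlambda [simp]: "a \<in> elts A \<Longrightarrow> app (vlambda A h) a = h a"
  unfolding app_def by (rule the_equality) (auto simp: elts_vlambda)

lemma vlambda_cong: "(\<And>a. a \<in> elts A \<Longrightarrow> h a = k a) \<Longrightarrow> vlambda A h = vlambda A k"
  by (rule extensionality) (auto simp: elts_vlambda)

lemma vfuns_app_graph:
  assumes "f \<in> vfuns A B" "a \<in> elts A"
  shows "vpair a (app f a) \<in> elts f"
proof -
  have "\<exists>!b. vpair a b \<in> elts f" using assms unfolding vfuns_def by blast
  then show ?thesis unfolding app_def by (rule theI')
qed

lemma app_vfuns: "f \<in> vfuns A B \<Longrightarrow> a \<in> elts A \<Longrightarrow> app f a \<in> elts B"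
  using vfuns_app_graph[of f A B a] unfolding vfuns_def by (auto simp: elts_vtimes)

lemma vfuns_eq_vlambda:
  assumes f: "f \<in> vfuns A B"
  shows "f = vlambda A (app f)"
proof (rule extensionality, rule set_eqI)
  fix p
  show "p \<in> elts f \<longleftrightarrow> p \<in> elts (vlambda A (app f))"
  proof
    assume p: "p \<in> elts f"
    then have "p \<in> elts (vtimes A B)" using f unfolding vfuns_def by blast
    then obtain a b where ab: "p = vpair a b" "a \<in> elts A" by (auto simp: elts_vtimes)
    have "\<exists>!b. vpair a b \<in> elts f" using f ab unfolding vfuns_def by blast
    then have "b = app f a" using p ab vfuns_app_graph[OF f] by blast
    then show "p \<in> elts (vlambda A (app f))" using ab by (auto simp: elts_vlambda)
  next
    assume "p \<in> elts (vlambda A (app f))"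
    then show "p \<in> elts f" using vfuns_app_graph[OF f] by (auto simp: elts_vlambda)
  qed
qed

lemma vfuns_ext:
  "f \<in> vfuns A B \<Longrightarrow> g \<in> vfuns A B' \<Longrightarrow> (\<And>a. a \<in> elts A \<Longrightarrow> app f a = app g a) \<Longrightarrow> f = g"
  using vfuns_eq_vlambda vlambda_cong by metis

lemma vlambda_vfuns: "(\<And>a. a \<in> elts A \<Longrightarrow> h a \<in> elts B) \<Longrightarrow> vlambda A h \<in> vfuns A B"
  unfolding vfuns_def by (auto simp: elts_vlambda elts_vtimes)


section \<open>Grothendieck universes\<close>

locale universe =
  fixes U :: "'v::zfc"
  assumes universe: "grothendieck_universe U"
begin

lemma mem_trans: "x \<in> elts U \<Longrightarrow> y \<in> elts x \<Longrightarrow> y \<in> elts U"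
  using universe unfolding grothendieck_universe_def by blast

lemma pair_in: "x \<in> elts U \<Longrightarrow> y \<in> elts U \<Longrightarrow> vset {x, y} \<in> elts U"
  using universe unfolding grothendieck_universe_def by blast

lemma Pow_in: "x \<in> elts U \<Longrightarrow> vset {z. elts z \<subseteq> elts x} \<in> elts U"
  using universe unfolding grothendieck_universe_def by blast

lemma UN_in: "I \<in> elts U \<Longrightarrow> (\<And>i. i \<in> elts I \<Longrightarrow> X i \<in> elts U) \<Longrightarrow>
    vset (\<Union>i\<in>elts I. elts (X i)) \<in> elts U"
  using universe unfolding grothendieck_universe_def by blast

lemma subset_in: "x \<in> elts U \<Longrightarrow> elts z \<subseteq> elts x \<Longrightarrow> z \<in> elts U"
  by (rule mem_trans[OF Pow_in]) (auto simp: elts_vset small_Pow)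

lemma vset_subset_in: "x \<in> elts U \<Longrightarrow> A \<subseteq> elts x \<Longrightarrow> vset A \<in> elts U"
  using subset_in[of x "vset A"] small_subset[OF small_elts] elts_vset by metis

lemma vpair_in: "x \<in> elts U \<Longrightarrow> y \<in> elts U \<Longrightarrow> vpair x y \<in> elts U"
  unfolding vpair_def using pair_in[of x x] pair_in by simp

lemma vset_UN_in:
  assumes "I \<in> elts U" and "\<And>i. i \<in> elts I \<Longrightarrow> small (X i) \<and> vset (X i) \<in> elts U"
  shows "vset (\<Union>i\<in>elts I. X i) \<in> elts U"
proof -
  have "(\<Union>i\<in>elts I. X i) = (\<Union>i\<in>elts I. elts (vset (X i)))" using assms(2) by (auto simp: elts_vset)
  then show ?thesis using UN_in[of I "\<lambda>i. vset (X i)"] assms by simp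
qed

lemma vset_image_in:
  assumes "I \<in> elts U" and "\<And>i. i \<in> elts I \<Longrightarrow> h i \<in> elts U"
  shows "vset (h ` elts I) \<in> elts U"
proof -
  have "h ` elts I = (\<Union>i\<in>elts I. {h i})" by auto
  moreover have "small {h i} \<and> vset {h i} \<in> elts U" if "i \<in> elts I" for i
    using pair_in[OF assms(2)[OF that] assms(2)[OF that]] by simp
  ultimately show ?thesis using vset_UN_in[of I "\<lambda>i. {h i}"] assms(1) by simp
qed

lemma vlambda_in:
  assumes "I \<in> elts U" and "\<And>i. i \<in> elts I \<Longrightarrow> h i \<in> elts U"
  shows "vlambda I h \<in> elts U"
proof -
  have "vlambda I h = vset ((\<lambda>i. vpair i (h i)) ` elts I)"
    unfolding vlambda_def by (rule arg_cong[where f = vset]) auto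
  then show ?thesis using assms by (simp add: vset_image_in vpair_in mem_trans)
qed

lemma vtimes_in:
  assumes A: "A \<in> elts U" and B: "B \<in> elts U"
  shows "vtimes A B \<in> elts U"
proof -
  have "elts (vtimes A B) = (\<Union>a\<in>elts A. (\<lambda>b. vpair a b) ` elts B)" by (auto simp: elts_vtimes)
  then have "vtimes A B = vset (\<Union>a\<in>elts A. (\<lambda>b. vpair a b) ` elts B)" by (metis vset_elts)
  also have "\<dots> \<in> elts U"
    by (intro vset_UN_in A conjI small_image small_elts vset_image_in B vpair_in)
       (use mem_trans A B in auto)
  finally show ?thesis .
qed

lemma vfuns_in: "A \<in> elts U \<Longrightarrow> B \<in> elts U \<Longrightarrow> f \<in> vfuns A B \<Longrightarrow> f \<in> elts U"
  unfolding vfuns_def using subset_in[OF vtimes_in] by blast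

end

section \<open>Categories given by operations\<close>

lemma Ob_mk_cat [simp]: "Ob (mk_cat Obj A d c i m) = Obj"
  and Arr_mk_cat [simp]: "Arr (mk_cat Obj A d c i m) = A"
  by (simp_all add: Ob_def Arr_def mk_cat_def)

lemma cdom_mk_cat [simp]: "f \<in> elts A \<Longrightarrow> cdom (mk_cat Obj A d c i m) f = d f"
  and ccod_mk_cat [simp]: "f \<in> elts A \<Longrightarrow> ccod (mk_cat Obj A d c i m) f = c f"
  and cid_mk_cat [simp]: "x \<in> elts Obj \<Longrightarrow> cid (mk_cat Obj A d c i m) x = i x"
  by (simp_all add: cdom_def ccod_def cid_def mk_cat_def)

lemma elts_composable:
  "elts (vset {vpair g f | g f. g \<in> elts A \<and> f \<in> elts A \<and> d g = c f}) =
    {vpair g f | g f. g \<in> elts A \<and> f \<in> elts A \<and> d g = c f}"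
  by (rule elts_vset, rule small_subset[OF small_elts[of "vtimes A A"]]) (auto simp: elts_vtimes)

lemma ccomp_mk_cat [simp]:
  "g \<in> elts A \<Longrightarrow> f \<in> elts A \<Longrightarrow> d g = c f \<Longrightarrow> ccomp (mk_cat Obj A d c i m) g f = m g f"
  by (simp add: ccomp_def mk_cat_def elts_composable)

lemma mk_cat_cong:
  assumes "\<And>f. f \<in> elts A \<Longrightarrow> d f = d' f" "\<And>f. f \<in> elts A \<Longrightarrow> c f = c' f"
    and "\<And>x. x \<in> elts Obj \<Longrightarrow> i x = i' x"
    and "\<And>g f. g \<in> elts A \<Longrightarrow> f \<in> elts A \<Longrightarrow> d g = c f \<Longrightarrow> m g f = m' g f"
  shows "mk_cat Obj A d c i m = mk_cat Obj A d' c' i' m'"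
proof -
  have comp: "{vpair g f | g f. g \<in> elts A \<and> f \<in> elts A \<and> d g = c f} =
      {vpair g f | g f. g \<in> elts A \<and> f \<in> elts A \<and> d' g = c' f}"
    using assms(1,2) by (intro Collect_cong) metis
  have "vlambda (vset {vpair g f | g f. g \<in> elts A \<and> f \<in> elts A \<and> d g = c f}) (\<lambda>p. m (vfst p) (vsnd p))
      = vlambda (vset {vpair g f | g f. g \<in> elts A \<and> f \<in> elts A \<and> d g = c f}) (\<lambda>p. m' (vfst p) (vsnd p))"
    by (rule vlambda_cong) (auto simp: elts_composable assms(4))
  then show ?thesis
    unfolding mk_cat_def using assms(1-3)
    by (auto intro!: vlambda_cong simp: comp)
qed

lemma chomI: "f \<in> elts (Arr C) \<Longrightarrow> cdom C f = x \<Longrightarrow> ccod C f = y \<Longrightarrow> f \<in> chom C x y"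
  unfolding chom_def by simp

lemma chomD: "f \<in> chom C x y \<Longrightarrow> f \<in> elts (Arr C) \<and> cdom C f = x \<and> ccod C f = y"
  unfolding chom_def by simp

lemma small_chom [simp]: "small (chom C x y)"
  by (rule small_subset[OF small_elts[of "Arr C"]]) (auto simp: chom_def)

lemma elts_chom [simp]: "elts (vset (chom C x y)) = chom C x y"
  by (rule elts_vset) simp

locale category =
  fixes C :: "'v::zfc"
  assumes category: "is_category C"
begin

lemma hom_ob: "f \<in> chom C x y \<Longrightarrow> x \<in> elts (Ob C) \<and> y \<in> elts (Ob C)"
  using category unfolding is_category_def chom_def by blast

lemma id_hom [simp]: "x \<in> elts (Ob C) \<Longrightarrow> cid C x \<in> chom C x x"
  using category unfolding is_category_def by blast

lemma comp_hom: "f \<in> chom C x y \<Longrightarrow> g \<in> chom C y z \<Longrightarrow> ccomp C g f \<in> chom C x z"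
  using category unfolding is_category_def by blast

lemma comp_id: "f \<in> chom C x y \<Longrightarrow> ccomp C f (cid C x) = f"
  and id_comp: "f \<in> chom C x y \<Longrightarrow> ccomp C (cid C y) f = f"
  using category unfolding is_category_def by blast+

lemma comp_assoc: "f \<in> chom C w x \<Longrightarrow> g \<in> chom C x y \<Longrightarrow> h \<in> chom C y z \<Longrightarrow>
    ccomp C h (ccomp C g f) = ccomp C (ccomp C h g) f"
  using category unfolding is_category_def by blast

end

lemma Ob_op [simp]: "Ob (op_cat C) = Ob C"
  and Arr_op [simp]: "Arr (op_cat C) = Arr C"
  by (simp_all add: op_cat_def)

lemma chom_op: "chom (op_cat C) x y = chom C y x"
  unfolding chom_def by (auto simp: op_cat_def)

lemma cid_op: "x \<in> elts (Ob C) \<Longrightarrow> cid (op_cat C) x = cid C x"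
  by (simp add: op_cat_def)

lemma ccomp_op: "f \<in> chom C y x \<Longrightarrow> g \<in> chom C z y \<Longrightarrow> ccomp (op_cat C) g f = ccomp C f g"
  by (simp add: op_cat_def chom_def)

lemma Ob_prod [simp]: "Ob (prod_cat C D) = vtimes (Ob C) (Ob D)"
  and Arr_prod [simp]: "Arr (prod_cat C D) = vtimes (Arr C) (Arr D)"
  by (simp_all add: prod_cat_def)

lemma chom_prod: "p \<in> chom (prod_cat C D) a b \<longleftrightarrow>
    (\<exists>x y x' y' f g. a = vpair x y \<and> b = vpair x' y' \<and> p = vpair f g \<and>
      f \<in> chom C x x' \<and> g \<in> chom D y y')"
  unfolding chom_def by (auto simp: prod_cat_def elts_vtimes)

lemma cid_prod: "x \<in> elts (Ob C) \<Longrightarrow> y \<in> elts (Ob D) \<Longrightarrow>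
    cid (prod_cat C D) (vpair x y) = vpair (cid C x) (cid D y)"
  by (simp add: prod_cat_def elts_vtimes)

lemma ccomp_prod:
  "f \<in> chom C x y \<Longrightarrow> f' \<in> chom C y z \<Longrightarrow> g \<in> chom D x' y' \<Longrightarrow> g' \<in> chom D y' z' \<Longrightarrow>
    ccomp (prod_cat C D) (vpair f' g') (vpair f g) = vpair (ccomp C f' f) (ccomp D g' g)"
  by (simp add: prod_cat_def elts_vtimes chom_def)


subsection \<open>The category of sets\<close>

lemma set_arr_inject [simp]: "set_arr A B h = set_arr A' B' h' \<longleftrightarrow> A = A' \<and> B = B' \<and> h = h'"
  by (simp add: set_arr_def)

lemma set_map_set_arr [simp]: "set_map (set_arr A B h) = h"
  by (simp add: set_map_def set_arr_def)

context universe
begin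

lemma Ob_set_cat [simp]: "Ob (set_cat U) = U"
  by (simp add: set_cat_def)

lemma Arr_set_cat: "elts (Arr (set_cat U)) =
    {set_arr A B h | A B h. A \<in> elts U \<and> B \<in> elts U \<and> h \<in> vfuns A B}"
proof -
  have "{set_arr A B h | A B h. A \<in> elts U \<and> B \<in> elts U \<and> h \<in> vfuns A B} \<subseteq> elts U"
    using vfuns_in by (auto simp: set_arr_def intro!: vpair_in)
  then show ?thesis
    unfolding set_cat_def Arr_mk_cat by (rule elts_vset[OF small_subset[OF small_elts]])
qed

lemma cdom_set_cat: "t \<in> elts (Arr (set_cat U)) \<Longrightarrow> cdom (set_cat U) t = vfst t"
  unfolding set_cat_def by simp

lemma ccod_set_cat: "t \<in> elts (Arr (set_cat U)) \<Longrightarrow> ccod (set_cat U) t = vfst (vsnd t)"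
  unfolding set_cat_def by simp

lemma chom_set_cat: "t \<in> chom (set_cat U) A B \<longleftrightarrow>
    A \<in> elts U \<and> B \<in> elts U \<and> (\<exists>h\<in>vfuns A B. t = set_arr A B h)"
  proof -
  have "t \<in> chom (set_cat U) A B \<longleftrightarrow> t \<in> elts (Arr (set_cat U)) \<and> vfst t = A \<and> vfst (vsnd t) = B"
    using cdom_set_cat ccod_set_cat unfolding chom_def by auto
  then show ?thesis unfolding Arr_set_cat by (auto simp: set_arr_def)
qed

lemma cid_set_cat: "A \<in> elts U \<Longrightarrow> cid (set_cat U) A = set_arr A A (vlambda A (\<lambda>a. a))"
  by (simp add: set_cat_def)

lemma ccomp_set_cat:
  assumes "A \<in> elts U" "B \<in> elts U" "K \<in> elts U" and h: "h \<in> vfuns A B" and k: "k \<in> vfuns B K"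
  shows "ccomp (set_cat U) (set_arr B K k) (set_arr A B h) =
    set_arr A K (vlambda A (\<lambda>a. app k (app h a)))"
proof -
  have "set_arr B K k \<in> elts (Arr (set_cat U))" "set_arr A B h \<in> elts (Arr (set_cat U))"
    using assms by (auto simp: Arr_set_cat)
  then show ?thesis unfolding set_cat_def Arr_mk_cat
    by (subst ccomp_mk_cat) (simp_all add: set_arr_def set_map_def)
qed

lemma set_iso_bij:
  assumes t: "t \<in> chom (set_cat U) A B" and iso: "is_iso (set_cat U) t"
  shows "bij_betw (app (set_map t)) (elts A) (elts B)"
proof -
  obtain A' B' s where t': "t \<in> chom (set_cat U) A' B'" and s: "s \<in> chom (set_cat U) B' A'"
    and st: "ccomp (set_cat U) s t = cid (set_cat U) A'"
    and ts: "ccomp (set_cat U) t s = cid (set_cat U) B'"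
    using iso unfolding is_iso_def by blast
  have [simp]: "A' = A" "B' = B" using t t' chomD by metis+
  obtain h where h: "h \<in> vfuns A B" "t = set_arr A B h" and U: "A \<in> elts U" "B \<in> elts U"
    using t by (auto simp: chom_set_cat)
  obtain k where k: "k \<in> vfuns B A" "s = set_arr B A k" using s by (auto simp: chom_set_cat)
  have kh: "vlambda A (\<lambda>a. app k (app h a)) = vlambda A (\<lambda>a. a)"
    using st h k U by (simp add: ccomp_set_cat cid_set_cat)
  have hk: "vlambda B (\<lambda>a. app h (app k a)) = vlambda B (\<lambda>a. a)"
    using ts h k U by (simp add: ccomp_set_cat cid_set_cat)
  have "app k (app h a) = a" if "a \<in> elts A" for a
    using arg_cong[OF kh, of "\<lambda>v. app v a"] that by simp
  moreover have "app h (app k b) = b" if "b \<in> elts B" for b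
    using arg_cong[OF hk, of "\<lambda>v. app v b"] that by simp
  ultimately show ?thesis using app_vfuns[OF h(1)] app_vfuns[OF k(1)]
    by (intro bij_betw_byWitness[where f' = "app k"]) (auto simp: h(2))
qed

lemma bij_set_iso:
  assumes U: "A \<in> elts U" "B \<in> elts U" and bij: "bij_betw \<theta> (elts A) (elts B)"
  shows "is_iso (set_cat U) (set_arr A B (vlambda A \<theta>))"
proof -
  define \<theta>' where "\<theta>' = inv_into (elts A) \<theta>"
  have \<theta>: "vlambda A \<theta> \<in> vfuns A B" by (rule vlambda_vfuns) (use bij bij_betwE in blast)
  have \<theta>'_in: "\<theta>' b \<in> elts A" if "b \<in> elts B" for b
    using that bij bij_betwE[OF bij_betw_inv_into[OF bij]] by (auto simp: \<theta>'_def)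
  then have \<theta>': "vlambda B \<theta>' \<in> vfuns B A" by (rule vlambda_vfuns)
  have in_B: "\<theta> a \<in> elts B" if "a \<in> elts A" for a using that bij bij_betwE by blast
  have "vlambda A (\<lambda>a. app (vlambda B \<theta>') (app (vlambda A \<theta>) a)) = vlambda A (\<lambda>a. a)"
    using bij by (intro vlambda_cong) (simp add: in_B \<theta>'_def bij_betw_inv_into_left)
  moreover have "vlambda B (\<lambda>a. app (vlambda A \<theta>) (app (vlambda B \<theta>') a)) = vlambda B (\<lambda>a. a)"
  proof (rule vlambda_cong)
    fix b assume b: "b \<in> elts B"
    have "\<theta> (\<theta>' b) = b" unfolding \<theta>'_def by (rule bij_betw_inv_into_right[OF bij b])
    then show "app (vlambda A \<theta>) (app (vlambda B \<theta>') b) = b" by (simp add: b \<theta>'_in)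
  qed
  ultimately show ?thesis unfolding is_iso_def
    by (intro exI[of _ A] exI[of _ B] exI[of _ "set_arr B A (vlambda B \<theta>')"])
       (use \<theta> \<theta>' U in \<open>auto simp: chom_set_cat ccomp_set_cat cid_set_cat\<close>)
qed

end

lemma fobj_mk_functor [simp]: "x \<in> elts (Ob C) \<Longrightarrow> fobj (mk_functor C ob ar) x = ob x"
  and farr_mk_functor [simp]: "f \<in> elts (Arr C) \<Longrightarrow> farr (mk_functor C ob ar) f = ar f"
  by (simp_all add: mk_functor_def fobj_def farr_def)

lemma mk_functor_eta: "mk_functor C (fobj (mk_functor C ob ar)) (farr (mk_functor C ob ar)) = mk_functor C ob ar"
  unfolding mk_functor_def[of C "fobj (mk_functor C ob ar)"]
  by (simp add: mk_functor_def fobj_def farr_def cong: vlambda_cong)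

section \<open>Profunctors as families of sets with an action\<close>

locale profunctor = universe U + C: category C + D: category D
  for U C D :: "'v::zfc" +
  fixes F :: 'v
  assumes prof: "is_prof U C D F"
begin

lemma prof_functor: "is_functor (prod_cat (op_cat C) D) (set_cat U) F"
  using prof unfolding is_prof_def .

lemma pobj_in: "x \<in> elts (Ob C) \<Longrightarrow> y \<in> elts (Ob D) \<Longrightarrow> pobj F x y \<in> elts U"
  using prof_functor unfolding is_functor_def pobj_def by (auto simp: elts_vtimes)

lemma hom_pair: "f \<in> chom C x' x \<Longrightarrow> g \<in> chom D y y' \<Longrightarrow>
    vpair f g \<in> chom (prod_cat (op_cat C) D) (vpair x y) (vpair x' y')"
  by (simp add: chom_prod chom_op)

lemma farr_eq:
  assumes f: "f \<in> chom C x' x" and g: "g \<in> chom D y y'"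
  shows "farr F (vpair f g) =
      set_arr (pobj F x y) (pobj F x' y') (vlambda (pobj F x y) (pact F f g))"
    and "vlambda (pobj F x y) (pact F f g) \<in> vfuns (pobj F x y) (pobj F x' y')"
proof -
  have "farr F (vpair f g) \<in> chom (set_cat U) (pobj F x y) (pobj F x' y')"
    using prof_functor hom_pair[OF f g] unfolding is_functor_def pobj_def by blast
  then obtain h where h: "h \<in> vfuns (pobj F x y) (pobj F x' y')"
      "farr F (vpair f g) = set_arr (pobj F x y) (pobj F x' y') h"
    by (auto simp: chom_set_cat)
  have "pact F f g = app h" by (rule ext) (simp add: pact_def h)
  then have "vlambda (pobj F x y) (pact F f g) = h" using vfuns_eq_vlambda[OF h(1)] by simp
  with h show "farr F (vpair f g) =
      set_arr (pobj F x y) (pobj F x' y') (vlambda (pobj F x y) (pact F f g))"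
    and "vlambda (pobj F x y) (pact F f g) \<in> vfuns (pobj F x y) (pobj F x' y')" by simp_all
qed

lemma pact_in: "f \<in> chom C x' x \<Longrightarrow> g \<in> chom D y y' \<Longrightarrow> a \<in> elts (pobj F x y) \<Longrightarrow>
    pact F f g a \<in> elts (pobj F x' y')"
  using app_vfuns[OF farr_eq(2), of f x' x g y y' a] by simp

lemma pact_id:
  assumes "x \<in> elts (Ob C)" "y \<in> elts (Ob D)" "a \<in> elts (pobj F x y)"
  shows "pact F (cid C x) (cid D y) a = a"
proof -
  have "vpair x y \<in> elts (Ob (prod_cat (op_cat C) D))" using assms by (simp add: elts_vtimes)
  then have "farr F (cid (prod_cat (op_cat C) D) (vpair x y)) = cid (set_cat U) (pobj F x y)"
    using prof_functor unfolding is_functor_def pobj_def by blast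
  then show ?thesis using assms
    by (simp add: cid_prod cid_op cid_set_cat pobj_in pact_def)
qed

lemma pact_comp:
  assumes f: "f \<in> chom C x' x" and g: "g \<in> chom D y y'"
    and f': "f' \<in> chom C x'' x'" and g': "g' \<in> chom D y' y''" and a: "a \<in> elts (pobj F x y)"
  shows "pact F f' g' (pact F f g a) = pact F (ccomp C f f') (ccomp D g' g) a"
proof -
  have "farr F (ccomp (prod_cat (op_cat C) D) (vpair f' g') (vpair f g)) =
      ccomp (set_cat U) (farr F (vpair f' g')) (farr F (vpair f g))"
    using prof_functor hom_pair[OF f g] hom_pair[OF f' g'] unfolding is_functor_def by blast
  also have "ccomp (prod_cat (op_cat C) D) (vpair f' g') (vpair f g) =
      vpair (ccomp C f f') (ccomp D g' g)"
    using f g f' g' by (subst ccomp_prod) (simp_all add: chom_op ccomp_op)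
  finally have "set_map (farr F (vpair (ccomp C f f') (ccomp D g' g))) =
      set_map (ccomp (set_cat U) (farr F (vpair f' g')) (farr F (vpair f g)))" by simp
  also have "\<dots> = vlambda (pobj F x y) (\<lambda>a. app (vlambda (pobj F x' y') (pact F f' g'))
      (app (vlambda (pobj F x y) (pact F f g)) a))"
    using C.hom_ob[OF f] D.hom_ob[OF g] C.hom_ob[OF f'] D.hom_ob[OF g']
    by (simp add: farr_eq(1)[OF f g] farr_eq(1)[OF f' g'] ccomp_set_cat pobj_in
        farr_eq(2)[OF f g] farr_eq(2)[OF f' g'])
  finally show ?thesis
    using a pact_in[OF f g a] by (simp add: pact_def[of _ "ccomp C f f'"])
qed

text \<open>
  By replacement and the closure properties of a universe, the graph of a functor from a
  small category to the category of sets of \<open>U\<close> is again an element of \<open>U\<close>. This is why an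
  isomorphism class of pointed functors is a subset of \<open>U\<close> and not a proper class.
\<close>

lemma prof_in:
  assumes "Ob C \<in> elts U" "Arr C \<in> elts U" "Ob D \<in> elts U" "Arr D \<in> elts U"
  shows "F \<in> elts U"
proof -
  let ?P = "prod_cat (op_cat C) D"
  have "farr F p \<in> elts U" if p: "p \<in> elts (vtimes (Arr C) (Arr D))" for p
  proof -
    obtain f g where fg: "p = vpair f g" "f \<in> elts (Arr C)" "g \<in> elts (Arr D)"
      using p by (auto simp: elts_vtimes)
    then have f: "f \<in> chom C (cdom C f) (ccod C f)" and g: "g \<in> chom D (cdom D g) (ccod D g)"
      by (auto intro: chomI)
    show ?thesis unfolding fg farr_eq(1)[OF f g] set_arr_def
      using C.hom_ob[OF f] D.hom_ob[OF g] farr_eq(2)[OF f g]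
      by (intro vpair_in pobj_in vfuns_in[OF _ _ farr_eq(2)[OF f g]]) auto
  qed
  moreover have "fobj F a \<in> elts U" if a: "a \<in> elts (vtimes (Ob C) (Ob D))" for a
    using that prof_functor unfolding is_functor_def by simp
  ultimately have "mk_functor ?P (fobj F) (farr F) \<in> elts U" unfolding mk_functor_def
    using assms by (intro vpair_in vlambda_in) (simp_all add: vtimes_in)
  then show ?thesis using prof_functor unfolding is_functor_def by simp
qed

end

text \<open>
  The converse of the laws above: a family of sets with an action given by set-theoretic functions
  \<open>k f g\<close> is a functor to the category of sets. Both the hom functor and the composite of two
  profunctors are literally of the shape \<open>F\<close> below.
\<close>

lemma (in universe) prof_mk_functor:
  fixes C D :: 'v
  assumes C: "is_category C" and D: "is_category D"
    and P: "\<And>x y. x \<in> elts (Ob C) \<Longrightarrow> y \<in> elts (Ob D) \<Longrightarrow> P x y \<in> elts U"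
    and k: "\<And>x x' y y' f g. f \<in> chom C x' x \<Longrightarrow> g \<in> chom D y y' \<Longrightarrow>
      k f g \<in> vfuns (P x y) (P x' y')"
    and k_id: "\<And>x y a. x \<in> elts (Ob C) \<Longrightarrow> y \<in> elts (Ob D) \<Longrightarrow> a \<in> elts (P x y) \<Longrightarrow>
      app (k (cid C x) (cid D y)) a = a"
    and k_comp: "\<And>x x' x'' y y' y'' f f' g g' a. f \<in> chom C x' x \<Longrightarrow> g \<in> chom D y y' \<Longrightarrow>
      f' \<in> chom C x'' x' \<Longrightarrow> g' \<in> chom D y' y'' \<Longrightarrow> a \<in> elts (P x y) \<Longrightarrow>
      app (k f' g') (app (k f g) a) = app (k (ccomp C f f') (ccomp D g' g)) a"
  defines "F \<equiv> mk_functor (prod_cat (op_cat C) D) (\<lambda>a. P (vfst a) (vsnd a))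
    (\<lambda>p. set_arr (P (ccod C (vfst p)) (cdom D (vsnd p))) (P (cdom C (vfst p)) (ccod D (vsnd p)))
          (k (vfst p) (vsnd p)))"
  shows "is_prof U C D F"
    and "\<And>x y. x \<in> elts (Ob C) \<Longrightarrow> y \<in> elts (Ob D) \<Longrightarrow> pobj F x y = P x y"
    and "\<And>x x' y y' f g a. f \<in> chom C x' x \<Longrightarrow> g \<in> chom D y y' \<Longrightarrow>
      pact F f g a = app (k f g) a"
proof -
  interpret C: category C by unfold_locales (rule C)
  interpret D: category D by unfold_locales (rule D)
  have fobj: "fobj F (vpair x y) = P x y" if "x \<in> elts (Ob C)" "y \<in> elts (Ob D)" for x y
    using that by (simp add: F_def elts_vtimes)
  have farr: "farr F (vpair f g) = set_arr (P x y) (P x' y') (k f g)"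
    if "f \<in> chom C x' x" "g \<in> chom D y y'" for f g x x' y y'
    using chomD[OF that(1)] chomD[OF that(2)] by (simp add: F_def elts_vtimes)
  have farr_hom: "farr F (vpair f g) \<in> chom (set_cat U) (P x y) (P x' y')"
    if "f \<in> chom C x' x" "g \<in> chom D y y'" for f g x x' y y'
    using that C.hom_ob[OF that(1)] D.hom_ob[OF that(2)] P k by (simp add: farr chom_set_cat)
  show "is_prof U C D F" unfolding is_prof_def is_functor_def
  proof (intro conjI ballI allI impI)
    show "F = mk_functor (prod_cat (op_cat C) D) (fobj F) (farr F)"
      unfolding F_def mk_functor_eta ..
  next
    fix a assume "a \<in> elts (Ob (prod_cat (op_cat C) D))"
    then obtain x y where a: "a = vpair x y" "x \<in> elts (Ob C)" "y \<in> elts (Ob D)"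
      by (auto simp: elts_vtimes)
    show "fobj F a \<in> elts (Ob (set_cat U))" using a P by (simp add: fobj)
    show "farr F (cid (prod_cat (op_cat C) D) a) = cid (set_cat U) (fobj F a)"
    proof -
      have "k (cid C x) (cid D y) = vlambda (P x y) (\<lambda>a. a)"
      proof (rule vfuns_ext)
        show "k (cid C x) (cid D y) \<in> vfuns (P x y) (P x y)" using a by (intro k) simp_all
        show "vlambda (P x y) (\<lambda>a. a) \<in> vfuns (P x y) (P x y)" by (rule vlambda_vfuns)
      qed (use a k_id in simp)
      then show ?thesis
        using a P by (simp add: cid_prod cid_op fobj cid_set_cat farr[of _ x x _ y y])
    qed
  next
    fix a b p assume "p \<in> chom (prod_cat (op_cat C) D) a b"
    then obtain x y x' y' f g where p: "a = vpair x y" "b = vpair x' y'" "p = vpair f g"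
        "f \<in> chom C x' x" "g \<in> chom D y y'"
      by (auto simp: chom_prod chom_op)
    then show "farr F p \<in> chom (set_cat U) (fobj F a) (fobj F b)"
      using farr_hom[OF p(4,5)] C.hom_ob[OF p(4)] D.hom_ob[OF p(5)] by (simp add: fobj)
  next
    fix a b c p q
    assume "p \<in> chom (prod_cat (op_cat C) D) a b" "q \<in> chom (prod_cat (op_cat C) D) b c"
    then obtain x y x' y' x'' y'' f g f' g' where p: "p = vpair f g" and q: "q = vpair f' g'"
      and f: "f \<in> chom C x' x" and g: "g \<in> chom D y y'"
      and f': "f' \<in> chom C x'' x'" and g': "g' \<in> chom D y' y''"
      by (auto simp: chom_prod chom_op)
    have comp: "ccomp (prod_cat (op_cat C) D) q p = vpair (ccomp C f f') (ccomp D g' g)"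
      using f g f' g' unfolding p q by (subst ccomp_prod) (simp_all add: chom_op ccomp_op)
    have ff: "ccomp C f f' \<in> chom C x'' x" by (rule C.comp_hom[OF f' f])
    have gg: "ccomp D g' g \<in> chom D y y''" by (rule D.comp_hom[OF g g'])
    have "ccomp (set_cat U) (farr F q) (farr F p) =
        set_arr (P x y) (P x'' y'') (vlambda (P x y) (\<lambda>a. app (k f' g') (app (k f g) a)))"
      unfolding p q farr[OF f g] farr[OF f' g']
      using C.hom_ob[OF f] D.hom_ob[OF g] C.hom_ob[OF f'] D.hom_ob[OF g']
      by (intro ccomp_set_cat P k f g f' g') simp_all
    also have "vlambda (P x y) (\<lambda>a. app (k f' g') (app (k f g) a)) =
        vlambda (P x y) (app (k (ccomp C f f') (ccomp D g' g)))"
      by (intro vlambda_cong k_comp[OF f g f' g'])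
    also have "\<dots> = k (ccomp C f f') (ccomp D g' g)"
      by (rule vfuns_eq_vlambda[OF k[OF ff gg], symmetric])
    finally show "farr F (ccomp (prod_cat (op_cat C) D) q p) =
        ccomp (set_cat U) (farr F q) (farr F p)"
      by (simp add: comp farr[OF ff gg])
  qed
  show "\<And>x y. x \<in> elts (Ob C) \<Longrightarrow> y \<in> elts (Ob D) \<Longrightarrow> pobj F x y = P x y"
    by (simp add: pobj_def fobj)
  show "\<And>x x' y y' f g a. f \<in> chom C x' x \<Longrightarrow> g \<in> chom D y y' \<Longrightarrow>
      pact F f g a = app (k f g) a"
    by (simp add: pact_def farr)
qed


subsection \<open>Isomorphisms of profunctors\<close>

text \<open>
  The content of a natural isomorphism without its set-theoretic coding: a natural isomorphism
  between functors to sets is a natural family of bijections. Coherence isomorphisms are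
  constructed in this form and coded as sets only once, in \<open>prof_iso_imp_nat_iso\<close>.
\<close>

definition prof_iso :: "'v::zfc \<Rightarrow> 'v \<Rightarrow> 'v \<Rightarrow> 'v \<Rightarrow> ('v \<Rightarrow> 'v \<Rightarrow> 'v \<Rightarrow> 'v) \<Rightarrow> bool"
  where "prof_iso C D F G \<theta> \<longleftrightarrow>
    (\<forall>x\<in>elts (Ob C). \<forall>y\<in>elts (Ob D). bij_betw (\<theta> x y) (elts (pobj F x y)) (elts (pobj G x y))) \<and>
    (\<forall>x x' y y' f g a. f \<in> chom C x' x \<longrightarrow> g \<in> chom D y y' \<longrightarrow> a \<in> elts (pobj F x y) \<longrightarrow>
       \<theta> x' y' (pact F f g a) = pact G f g (\<theta> x y a))"

lemma
  assumes "prof_iso C D F G \<theta>"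
  shows prof_iso_bij: "x \<in> elts (Ob C) \<Longrightarrow> y \<in> elts (Ob D) \<Longrightarrow>
      bij_betw (\<theta> x y) (elts (pobj F x y)) (elts (pobj G x y))"
    and prof_iso_in: "x \<in> elts (Ob C) \<Longrightarrow> y \<in> elts (Ob D) \<Longrightarrow> a \<in> elts (pobj F x y) \<Longrightarrow>
      \<theta> x y a \<in> elts (pobj G x y)"
    and prof_iso_nat: "f \<in> chom C x' x \<Longrightarrow> g \<in> chom D y y' \<Longrightarrow> a \<in> elts (pobj F x y) \<Longrightarrow>
      \<theta> x' y' (pact F f g a) = pact G f g (\<theta> x y a)"
  using assms unfolding prof_iso_def by (blast dest: bij_betwE)+

locale two_profunctors = F: profunctor U C D F + G: profunctor U C D G
  for U C D F G :: "'v::zfc"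
begin

lemma nat_iso_imp_prof_iso:
  assumes N: "is_nat_iso (prod_cat (op_cat C) D) (set_cat U) F G N"
  shows "prof_iso C D F G (\<lambda>x y. app (set_map (app N (vpair x y))))"
proof -
  have N_hom: "app N (vpair x y) \<in> chom (set_cat U) (pobj F x y) (pobj G x y)"
    and N_iso: "is_iso (set_cat U) (app N (vpair x y))"
    if "x \<in> elts (Ob C)" "y \<in> elts (Ob D)" for x y
    using N that unfolding is_nat_iso_def is_nat_trans_def pobj_def by (auto simp: elts_vtimes)
  have nat: "app (set_map (app N (vpair x' y'))) (pact F f g a) =
      pact G f g (app (set_map (app N (vpair x y))) a)"
    if f: "f \<in> chom C x' x" and g: "g \<in> chom D y y'" and a: "a \<in> elts (pobj F x y)"
    for x x' y y' f g a
  proof -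
    have ob: "x \<in> elts (Ob C)" "x' \<in> elts (Ob C)" "y \<in> elts (Ob D)" "y' \<in> elts (Ob D)"
      using F.C.hom_ob[OF f] F.D.hom_ob[OF g] by auto
    obtain h where h: "h \<in> vfuns (pobj F x y) (pobj G x y)"
        "app N (vpair x y) = set_arr (pobj F x y) (pobj G x y) h"
      using N_hom[of x y] ob by (auto simp: F.chom_set_cat)
    obtain h' where h': "h' \<in> vfuns (pobj F x' y') (pobj G x' y')"
        "app N (vpair x' y') = set_arr (pobj F x' y') (pobj G x' y') h'"
      using N_hom[of x' y'] ob by (auto simp: F.chom_set_cat)
    have "ccomp (set_cat U) (app N (vpair x' y')) (farr F (vpair f g)) =
        ccomp (set_cat U) (farr G (vpair f g)) (app N (vpair x y))"
      using N F.hom_pair[OF f g] unfolding is_nat_iso_def is_nat_trans_def by blast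
    then have "vlambda (pobj F x y) (\<lambda>a. app h' (app (vlambda (pobj F x y) (pact F f g)) a)) =
        vlambda (pobj F x y) (\<lambda>a. app (vlambda (pobj G x y) (pact G f g)) (app h a))"
      using h h' ob F.farr_eq[OF f g] G.farr_eq[OF f g]
      by (simp add: F.ccomp_set_cat F.pobj_in G.pobj_in)
    from arg_cong[OF this, of "\<lambda>v. app v a"] show ?thesis
      using a h h' app_vfuns[OF h(1) a] by simp
  qed
  show ?thesis unfolding prof_iso_def
    using F.set_iso_bij[OF N_hom N_iso] nat by blast
qed

lemma prof_iso_imp_nat_iso:
  assumes \<theta>: "prof_iso C D F G \<theta>"
  defines "N \<equiv> vlambda (Ob (prod_cat (op_cat C) D))
    (\<lambda>p. set_arr (fobj F p) (fobj G p) (vlambda (fobj F p) (\<theta> (vfst p) (vsnd p))))"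
  shows "is_nat_iso (prod_cat (op_cat C) D) (set_cat U) F G N"
    and "x \<in> elts (Ob C) \<Longrightarrow> y \<in> elts (Ob D) \<Longrightarrow> a \<in> elts (pobj F x y) \<Longrightarrow>
      app (set_map (app N (vpair x y))) a = \<theta> x y a"
proof -
  have N: "app N (vpair x y) =
      set_arr (pobj F x y) (pobj G x y) (vlambda (pobj F x y) (\<theta> x y))"
    if "x \<in> elts (Ob C)" "y \<in> elts (Ob D)" for x y
    using that by (simp add: N_def elts_vtimes pobj_def)
  have \<theta>_fun: "vlambda (pobj F x y) (\<theta> x y) \<in> vfuns (pobj F x y) (pobj G x y)"
    if "x \<in> elts (Ob C)" "y \<in> elts (Ob D)" for x y
    using prof_iso_in[OF \<theta> that] by (rule vlambda_vfuns)
  show "is_nat_iso (prod_cat (op_cat C) D) (set_cat U) F G N"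
    unfolding is_nat_iso_def is_nat_trans_def
  proof (intro conjI ballI allI impI)
    show "is_functor (prod_cat (op_cat C) D) (set_cat U) F"
      "is_functor (prod_cat (op_cat C) D) (set_cat U) G"
      by (rule F.prof_functor, rule G.prof_functor)
    show "N = vlambda (Ob (prod_cat (op_cat C) D)) (app N)"
      unfolding N_def by (rule vlambda_cong) simp
  next
    fix a assume "a \<in> elts (Ob (prod_cat (op_cat C) D))"
    then obtain x y where a: "a = vpair x y" "x \<in> elts (Ob C)" "y \<in> elts (Ob D)"
      by (auto simp: elts_vtimes)
    show "app N a \<in> chom (set_cat U) (fobj F a) (fobj G a)"
      using a \<theta>_fun N F.pobj_in G.pobj_in by (simp add: F.chom_set_cat pobj_def[symmetric])
    show "is_iso (set_cat U) (app N a)"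
      using a N F.bij_set_iso[OF F.pobj_in G.pobj_in prof_iso_bij[OF \<theta>]] by simp
  next
    fix a b p assume "p \<in> chom (prod_cat (op_cat C) D) a b"
    then obtain x y x' y' f g where p: "a = vpair x y" "b = vpair x' y'" "p = vpair f g"
      and f: "f \<in> chom C x' x" and g: "g \<in> chom D y y'"
      by (auto simp: chom_prod chom_op)
    have ob: "x \<in> elts (Ob C)" "x' \<in> elts (Ob C)" "y \<in> elts (Ob D)" "y' \<in> elts (Ob D)"
      using F.C.hom_ob[OF f] F.D.hom_ob[OF g] by auto
    have "vlambda (pobj F x y) (\<lambda>a. app (vlambda (pobj F x' y') (\<theta> x' y'))
            (app (vlambda (pobj F x y) (pact F f g)) a)) =
        vlambda (pobj F x y) (\<lambda>a. app (vlambda (pobj G x y) (pact G f g))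
            (app (vlambda (pobj F x y) (\<theta> x y)) a))"
      by (rule vlambda_cong)
         (simp add: F.pact_in[OF f g] prof_iso_in[OF \<theta>] ob prof_iso_nat[OF \<theta> f g])
    then show "ccomp (set_cat U) (app N b) (farr F p) = ccomp (set_cat U) (farr G p) (app N a)"
      using ob \<theta>_fun F.farr_eq[OF f g] G.farr_eq[OF f g]
      by (simp add: p N F.ccomp_set_cat F.pobj_in G.pobj_in)
  qed
  show "x \<in> elts (Ob C) \<Longrightarrow> y \<in> elts (Ob D) \<Longrightarrow> a \<in> elts (pobj F x y) \<Longrightarrow>
      app (set_map (app N (vpair x y))) a = \<theta> x y a"
    by (simp add: N)
qed

end

lemma (in universe) pointed_iso_iff:
  fixes C D :: 'v
  assumes C: "is_category C" and D: "is_category D" and x: "x \<in> elts (Ob C)" and y: "y \<in> elts (Ob D)"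
  shows "(vpair F \<phi>, vpair G \<psi>) \<in> pointed_iso U C x D y \<longleftrightarrow>
    is_prof U C D F \<and> \<phi> \<in> elts (pobj F x y) \<and> is_prof U C D G \<and> \<psi> \<in> elts (pobj G x y) \<and>
    (\<exists>\<theta>. prof_iso C D F G \<theta> \<and> \<theta> x y \<phi> = \<psi>)"
proof -
  have "(\<exists>N. is_nat_iso (prod_cat (op_cat C) D) (set_cat U) F G N \<and>
            app (set_map (app N (vpair x y))) \<phi> = \<psi>) \<longleftrightarrow>
      (\<exists>\<theta>. prof_iso C D F G \<theta> \<and> \<theta> x y \<phi> = \<psi>)"
    if "is_prof U C D F" "is_prof U C D G" "\<phi> \<in> elts (pobj F x y)"
  proof -
    interpret two_profunctors U C D F G by unfold_locales (fact C D that)+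
    show ?thesis
      using nat_iso_imp_prof_iso prof_iso_imp_nat_iso x y that by blast
  qed
  then show ?thesis unfolding pointed_iso_def by auto
qed

text \<open>
  The actions in the two variables commute, and together they give the action of a pair.
\<close>

context profunctor
begin

lemma pact_left_right:
  assumes f: "f \<in> chom C x' x" and g: "g \<in> chom D y y'" and a: "a \<in> elts (pobj F x y)"
  shows "pact F (cid C x') g (pact F f (cid D y) a) = pact F f g a"
  using pact_comp[OF f D.id_hom C.id_hom g a] C.hom_ob[OF f] D.hom_ob[OF g]
  by (simp add: C.comp_id[OF f] D.comp_id[OF g])

lemma pact_right_left:
  assumes f: "f \<in> chom C x' x" and g: "g \<in> chom D y y'" and a: "a \<in> elts (pobj F x y)"
  shows "pact F f (cid D y') (pact F (cid C x) g a) = pact F f g a"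
  using pact_comp[OF C.id_hom g f D.id_hom a] C.hom_ob[OF f] D.hom_ob[OF g]
  by (simp add: C.id_comp[OF f] D.id_comp[OF g])

lemma pact_comp_left:
  assumes f: "f \<in> chom C x' x" and f': "f' \<in> chom C x'' x'"
    and y: "y \<in> elts (Ob D)" and a: "a \<in> elts (pobj F x y)"
  shows "pact F f' (cid D y) (pact F f (cid D y) a) = pact F (ccomp C f f') (cid D y) a"
  using pact_comp[OF f D.id_hom f' D.id_hom a] y D.comp_id[OF D.id_hom] by simp

lemma pact_comp_right:
  assumes g: "g \<in> chom D y y'" and g': "g' \<in> chom D y' y''"
    and x: "x \<in> elts (Ob C)" and a: "a \<in> elts (pobj F x y)"
  shows "pact F (cid C x) g' (pact F (cid C x) g a) = pact F (cid C x) (ccomp D g' g) a"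
  using pact_comp[OF C.id_hom g C.id_hom g' a] x C.comp_id[OF C.id_hom] by simp

end

lemma prof_iso_refl: "prof_iso C D F F (\<lambda>x y a. a)"
  unfolding prof_iso_def by (simp add: bij_betw_def)

lemma prof_iso_trans:
  assumes "prof_iso C D F G \<theta>" "prof_iso C D G H \<eta>" "is_category C" "is_category D"
  shows "prof_iso C D F H (\<lambda>x y a. \<eta> x y (\<theta> x y a))"
proof -
  interpret C: category C by unfold_locales fact
  interpret D: category D by unfold_locales fact
  show ?thesis unfolding prof_iso_def
  proof (intro conjI ballI allI impI)
    fix x y assume "x \<in> elts (Ob C)" "y \<in> elts (Ob D)"
    then show "bij_betw (\<lambda>a. \<eta> x y (\<theta> x y a)) (elts (pobj F x y)) (elts (pobj H x y))"
      using bij_betw_trans[OF prof_iso_bij[OF assms(1)] prof_iso_bij[OF assms(2)]]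
      by (simp add: comp_def)
  next
    fix x x' y y' f g a
    assume f: "f \<in> chom C x' x" and g: "g \<in> chom D y y'" and a: "a \<in> elts (pobj F x y)"
    then have "\<theta> x y a \<in> elts (pobj G x y)"
      using prof_iso_in[OF assms(1)] C.hom_ob[OF f] D.hom_ob[OF g] by blast
    then show "\<eta> x' y' (\<theta> x' y' (pact F f g a)) = pact H f g (\<eta> x y (\<theta> x y a))"
      using prof_iso_nat[OF assms(1) f g a] prof_iso_nat[OF assms(2) f g] by simp
  qed
qed

lemma (in two_profunctors) prof_iso_sym:
  assumes \<theta>: "prof_iso C D F G \<theta>"
  obtains \<eta> where "prof_iso C D G F \<eta>"
    and "\<And>x y a. x \<in> elts (Ob C) \<Longrightarrow> y \<in> elts (Ob D) \<Longrightarrow> a \<in> elts (pobj F x y) \<Longrightarrow>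
      \<eta> x y (\<theta> x y a) = a"
    and "\<And>x y b. x \<in> elts (Ob C) \<Longrightarrow> y \<in> elts (Ob D) \<Longrightarrow> b \<in> elts (pobj G x y) \<Longrightarrow>
      \<theta> x y (\<eta> x y b) = b"
proof
  define \<eta> where "\<eta> = (\<lambda>x y. inv_into (elts (pobj F x y)) (\<theta> x y))"
  show left: "\<eta> x y (\<theta> x y a) = a"
    if "x \<in> elts (Ob C)" "y \<in> elts (Ob D)" "a \<in> elts (pobj F x y)" for x y a
    unfolding \<eta>_def by (rule bij_betw_inv_into_left[OF prof_iso_bij[OF \<theta> that(1,2)] that(3)])
  show right: "\<theta> x y (\<eta> x y b) = b"
    if "x \<in> elts (Ob C)" "y \<in> elts (Ob D)" "b \<in> elts (pobj G x y)" for x y b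
    unfolding \<eta>_def by (rule bij_betw_inv_into_right[OF prof_iso_bij[OF \<theta> that(1,2)] that(3)])
  have bij: "bij_betw (\<eta> x y) (elts (pobj G x y)) (elts (pobj F x y))"
    if "x \<in> elts (Ob C)" "y \<in> elts (Ob D)" for x y
    unfolding \<eta>_def by (rule bij_betw_inv_into[OF prof_iso_bij[OF \<theta> that]])
  have "\<eta> x' y' (pact G f g b) = pact F f g (\<eta> x y b)"
    if f: "f \<in> chom C x' x" and g: "g \<in> chom D y y'" and b: "b \<in> elts (pobj G x y)"
    for x x' y y' f g b
  proof -
    have ob: "x \<in> elts (Ob C)" "x' \<in> elts (Ob C)" "y \<in> elts (Ob D)" "y' \<in> elts (Ob D)"
      using F.C.hom_ob[OF f] F.D.hom_ob[OF g] by auto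
    have \<eta>b: "\<eta> x y b \<in> elts (pobj F x y)" using bij[OF ob(1,3)] b bij_betwE by blast
    have "pact G f g b = \<theta> x' y' (pact F f g (\<eta> x y b))"
      by (simp add: prof_iso_nat[OF \<theta> f g \<eta>b] right ob b)
    then show ?thesis by (simp add: left ob F.pact_in[OF f g \<eta>b])
  qed
  then show "prof_iso C D G F \<eta>" unfolding prof_iso_def using bij by blast
qed

lemma (in universe) equiv_pointed_iso:
  fixes C D :: 'v
  assumes C: "is_category C" and D: "is_category D" and x: "x \<in> elts (Ob C)" and y: "y \<in> elts (Ob D)"
  shows "equiv {vpair F \<phi> | F \<phi>. is_prof U C D F \<and> \<phi> \<in> elts (pobj F x y)} (pointed_iso U C x D y)"
proof (rule equivI)
  note iff = pointed_iso_iff[OF assms]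
  show "refl_on {vpair F \<phi> | F \<phi>. is_prof U C D F \<and> \<phi> \<in> elts (pobj F x y)} (pointed_iso U C x D y)"
    unfolding refl_on_def by (auto simp: iff intro!: exI[of _ "\<lambda>x y a. a"] prof_iso_refl)
  show "pointed_iso U C x D y \<subseteq>
      {vpair F \<phi> | F \<phi>. is_prof U C D F \<and> \<phi> \<in> elts (pobj F x y)} \<times>
      {vpair F \<phi> | F \<phi>. is_prof U C D F \<and> \<phi> \<in> elts (pobj F x y)}"
    unfolding pointed_iso_def by blast
  show "sym (pointed_iso U C x D y)"
  proof (rule symI)
    fix p q assume pq: "(p, q) \<in> pointed_iso U C x D y"
    then obtain F \<phi> G \<psi> where [simp]: "p = vpair F \<phi>" "q = vpair G \<psi>"
      unfolding pointed_iso_def by blast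
    have h: "is_prof U C D F" "is_prof U C D G" "\<phi> \<in> elts (pobj F x y)" "\<psi> \<in> elts (pobj G x y)"
      using pq by (simp_all add: iff)
    obtain \<theta> where \<theta>: "prof_iso C D F G \<theta>" "\<theta> x y \<phi> = \<psi>" using pq by (auto simp: iff)
    interpret two_profunctors U C D F G by unfold_locales (fact C D h)+
    obtain \<eta> where "prof_iso C D G F \<eta>" "\<eta> x y (\<theta> x y \<phi>) = \<phi>"
      using prof_iso_sym[OF \<theta>(1)] x y h by metis
    then show "(q, p) \<in> pointed_iso U C x D y" using h \<theta> by (auto simp: iff)
  qed
  show "Relation.trans (pointed_iso U C x D y)"
  proof (rule transI)
    fix p q r assume pq: "(p, q) \<in> pointed_iso U C x D y" and qr: "(q, r) \<in> pointed_iso U C x D y"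
    then obtain F \<phi> G \<psi> H \<chi> where [simp]: "p = vpair F \<phi>" "q = vpair G \<psi>" "r = vpair H \<chi>"
      unfolding pointed_iso_def by blast
    obtain \<theta> where \<theta>: "prof_iso C D F G \<theta>" "\<theta> x y \<phi> = \<psi>" using pq by (auto simp: iff)
    obtain \<eta> where \<eta>: "prof_iso C D G H \<eta>" "\<eta> x y \<psi> = \<chi>" using qr by (auto simp: iff)
    show "(p, r) \<in> pointed_iso U C x D y"
      using pq qr \<theta>(2) \<eta>(2) prof_iso_trans[OF \<theta>(1) \<eta>(1) C D] by (auto simp: iff)
  qed
qed


section \<open>The composite of two profunctors\<close>

locale composable = F: profunctor U C D F + G: profunctor U D E G
  for U C D E F G :: "'v::zfc" +
  assumes Ob_D: "Ob D \<in> elts U"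
begin

abbreviation "cls \<equiv> tensor_class C D E F G"
abbreviation "FG \<equiv> tensor C D E F G"

lemma coprod_eq_UN: "coprod D F G x z =
    vset (\<Union>y\<in>elts (Ob D). vpair y ` elts (vtimes (pobj F x y) (pobj G y z)))"
  unfolding coprod_def by (rule arg_cong[where f = vset]) (auto simp: elts_vtimes)

lemma elts_coprod: "elts (coprod D F G x z) = {vpair y (vpair \<phi> \<psi>) | y \<phi> \<psi>.
    y \<in> elts (Ob D) \<and> \<phi> \<in> elts (pobj F x y) \<and> \<psi> \<in> elts (pobj G y z)}"
proof -
  have "elts (coprod D F G x z) =
      (\<Union>y\<in>elts (Ob D). vpair y ` elts (vtimes (pobj F x y) (pobj G y z)))"
    unfolding coprod_eq_UN by (intro elts_vset small_UN small_image small_elts)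
  then show ?thesis by (auto simp: elts_vtimes)
qed

lemma coprod_in:
  assumes "x \<in> elts (Ob C)" "z \<in> elts (Ob E)"
  shows "coprod D F G x z \<in> elts U"
  unfolding coprod_eq_UN
proof (intro F.vset_UN_in Ob_D conjI small_image small_elts F.vset_image_in F.vtimes_in)
  fix y p assume y: "y \<in> elts (Ob D)" and p: "p \<in> elts (vtimes (pobj F x y) (pobj G y z))"
  have "vtimes (pobj F x y) (pobj G y z) \<in> elts U"
    using y assms by (intro F.vtimes_in F.pobj_in G.pobj_in)
  then show "vpair y p \<in> elts U"
    using y p F.mem_trans Ob_D by (intro F.vpair_in) blast+
qed (use assms in \<open>auto intro: F.pobj_in G.pobj_in\<close>)

lemma equiv_R': "equiv (elts (coprod D F G x z)) (R' C D E F G x z)"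
  by (rule equivI)
     (auto simp: R'_def refl_on_def sym_def intro!: transI intro: equivclp_sym equivclp_trans)

lemma elts_tensor_obj: "elts (tensor_obj C D E F G x z) =
    {cls x z y \<phi> \<psi> | y \<phi> \<psi>. y \<in> elts (Ob D) \<and> \<phi> \<in> elts (pobj F x y) \<and> \<psi> \<in> elts (pobj G y z)}"
proof -
  have "small (vset ` (elts (coprod D F G x z) // R' C D E F G x z))"
  proof (rule small_subset)
    show "small {v. elts v \<subseteq> elts (coprod D F G x z)}" by (rule small_Pow)
    have "elts (vset X) \<subseteq> elts (coprod D F G x z)"
      if "X \<in> elts (coprod D F G x z) // R' C D E F G x z" for X
      using Union_quotient[OF equiv_R'] that elts_vset[of X] small_subset[OF small_elts]
      by (metis Sup_upper)
    then show "vset ` (elts (coprod D F G x z) // R' C D E F G x z)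
        \<subseteq> {v. elts v \<subseteq> elts (coprod D F G x z)}" by blast
  qed
  then have "elts (tensor_obj C D E F G x z) = vset ` (elts (coprod D F G x z) // R' C D E F G x z)"
    unfolding tensor_obj_def vquot_def by (rule elts_vset)
  then show ?thesis unfolding quotient_def tensor_class_def vclass_def elts_coprod by blast
qed

lemma tensor_objE:
  assumes "c \<in> elts (tensor_obj C D E F G x z)"
  obtains y \<phi> \<psi> where "y \<in> elts (Ob D)" "\<phi> \<in> elts (pobj F x y)" "\<psi> \<in> elts (pobj G y z)"
    "c = cls x z y \<phi> \<psi>"
  using assms unfolding elts_tensor_obj by blast

lemma cls_in: "y \<in> elts (Ob D) \<Longrightarrow> \<phi> \<in> elts (pobj F x y) \<Longrightarrow> \<psi> \<in> elts (pobj G y z) \<Longrightarrow>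
    cls x z y \<phi> \<psi> \<in> elts (tensor_obj C D E F G x z)"
  unfolding elts_tensor_obj by blast

lemma cls_eq_iff:
  assumes "y \<in> elts (Ob D)" "\<phi> \<in> elts (pobj F x y)" "\<psi> \<in> elts (pobj G y z)"
    and "y' \<in> elts (Ob D)" "\<phi>' \<in> elts (pobj F x y')" "\<psi>' \<in> elts (pobj G y' z)"
  shows "cls x z y \<phi> \<psi> = cls x z y' \<phi>' \<psi>' \<longleftrightarrow>
    (vpair y (vpair \<phi> \<psi>), vpair y' (vpair \<phi>' \<psi>')) \<in> R' C D E F G x z"
proof -
  have p: "vpair y (vpair \<phi> \<psi>) \<in> elts (coprod D F G x z)"
      "vpair y' (vpair \<phi>' \<psi>') \<in> elts (coprod D F G x z)"
    using assms by (auto simp: elts_coprod)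
  have "small (R' C D E F G x z `` {q})" for q
    by (rule small_subset[OF small_elts[of "coprod D F G x z"]]) (auto simp: R'_def)
  then show ?thesis unfolding tensor_class_def vclass_def
    using eq_equiv_class_iff[OF equiv_R' p] by (simp add: vset_inject)
qed

lemma tensor_obj_in:
  assumes "x \<in> elts (Ob C)" "z \<in> elts (Ob E)"
  shows "tensor_obj C D E F G x z \<in> elts U"
proof -
  have "R' C D E F G x z `` {p} \<subseteq> elts (coprod D F G x z)" for p by (auto simp: R'_def)
  then have "elts (cls x z y \<phi> \<psi>) \<subseteq> elts (coprod D F G x z)" for y \<phi> \<psi>
    unfolding tensor_class_def vclass_def
    using elts_vset[OF small_subset[OF small_elts]] by metis
  then have "elts (tensor_obj C D E F G x z) \<subseteq> elts (vset {v. elts v \<subseteq> elts (coprod D F G x z)})"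
    unfolding elts_tensor_obj by (auto simp: elts_vset small_Pow)
  then show ?thesis by (rule F.subset_in[OF F.Pow_in[OF coprod_in[OF assms]]])
qed

text \<open>
  The sliding rule, which generates the quotient: an arrow of the middle category may be moved
  from one factor to the other.
\<close>

lemma cls_slide:
  assumes x: "x \<in> elts (Ob C)" and z: "z \<in> elts (Ob E)" and f: "f \<in> chom D y y'"
    and \<phi>: "\<phi> \<in> elts (pobj F x y)" and \<psi>: "\<psi> \<in> elts (pobj G y' z)"
  shows "cls x z y \<phi> (pact G f (cid E z) \<psi>) = cls x z y' (pact F (cid C x) f \<phi>) \<psi>"
proof -
  have ob: "y \<in> elts (Ob D)" "y' \<in> elts (Ob D)" using F.D.hom_ob[OF f] by auto
  have \<psi>': "pact G f (cid E z) \<psi> \<in> elts (pobj G y z)"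
    by (rule G.pact_in[OF f G.D.id_hom[OF z] \<psi>])
  have \<phi>': "pact F (cid C x) f \<phi> \<in> elts (pobj F x y')"
    by (rule F.pact_in[OF F.C.id_hom[OF x] f \<phi>])
  have "R'_gen C D E F G x z (vpair y (vpair \<phi> (pact G f (cid E z) \<psi>)))
      (vpair y' (vpair (pact F (cid C x) f \<phi>) \<psi>))"
    unfolding R'_gen_def elts_coprod using ob \<phi> \<psi> \<phi>' \<psi>' f by blast
  then have "equivclp (R'_gen C D E F G x z) (vpair y (vpair \<phi> (pact G f (cid E z) \<psi>)))
      (vpair y' (vpair (pact F (cid C x) f \<phi>) \<psi>))"
    by (rule r_into_equivclp)
  then show ?thesis
    using ob \<phi> \<psi> \<phi>' \<psi>' by (subst cls_eq_iff) (auto simp: R'_def elts_coprod)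
qed

end

text \<open>
  A function on the coproduct descends to the quotient as soon as it is constant on the generating
  pairs; all maps out of a composite are obtained in this way. The value of \<open>tensor_lift\<close> is
  unspecified when \<open>k\<close> is not balanced or \<open>c\<close> is not a class.
\<close>

definition balanced ::
    "'v::zfc \<Rightarrow> 'v \<Rightarrow> 'v \<Rightarrow> 'v \<Rightarrow> 'v \<Rightarrow> 'v \<Rightarrow> 'v \<Rightarrow> ('v \<Rightarrow> 'v \<Rightarrow> 'v \<Rightarrow> 'v) \<Rightarrow> bool"
  where "balanced C D E F G x z k \<longleftrightarrow>
    (\<forall>y y' f \<phi> \<psi>. f \<in> chom D y y' \<longrightarrow> \<phi> \<in> elts (pobj F x y) \<longrightarrow> \<psi> \<in> elts (pobj G y' z) \<longrightarrow>
       k y \<phi> (pact G f (cid E z) \<psi>) = k y' (pact F (cid C x) f \<phi>) \<psi>)"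

definition tensor_lift ::
    "'v::zfc \<Rightarrow> 'v \<Rightarrow> 'v \<Rightarrow> 'v \<Rightarrow> 'v \<Rightarrow> 'v \<Rightarrow> 'v \<Rightarrow> ('v \<Rightarrow> 'v \<Rightarrow> 'v \<Rightarrow> 'v) \<Rightarrow> 'v \<Rightarrow> 'v"
  where "tensor_lift C D E F G x z k c =
    (SOME v. \<exists>y \<phi> \<psi>. y \<in> elts (Ob D) \<and> \<phi> \<in> elts (pobj F x y) \<and> \<psi> \<in> elts (pobj G y z) \<and>
       c = tensor_class C D E F G x z y \<phi> \<psi> \<and> v = k y \<phi> \<psi>)"

lemma balancedI:
  "(\<And>y y' f \<phi> \<psi>. f \<in> chom D y y' \<Longrightarrow> \<phi> \<in> elts (pobj F x y) \<Longrightarrow> \<psi> \<in> elts (pobj G y' z) \<Longrightarrow>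
     k y \<phi> (pact G f (cid E z) \<psi>) = k y' (pact F (cid C x) f \<phi>) \<psi>) \<Longrightarrow>
   balanced C D E F G x z k"
  unfolding balanced_def by blast

context composable
begin

lemma balanced_cls_eq:
  assumes k: "balanced C D E F G x z k"
    and "y \<in> elts (Ob D)" "\<phi> \<in> elts (pobj F x y)" "\<psi> \<in> elts (pobj G y z)"
    and "y' \<in> elts (Ob D)" "\<phi>' \<in> elts (pobj F x y')" "\<psi>' \<in> elts (pobj G y' z)"
    and eq: "cls x z y \<phi> \<psi> = cls x z y' \<phi>' \<psi>'"
  shows "k y \<phi> \<psi> = k y' \<phi>' \<psi>'"
proof -
  define k' where "k' p = k (vfst p) (vfst (vsnd p)) (vsnd (vsnd p))" for p
  have gen: "k' p = k' q" if pq: "R'_gen C D E F G x z p q" for p q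
  proof -
    obtain y \<phi> \<psi> y' \<phi>' \<psi>' f where *: "p = vpair y (vpair \<phi> \<psi>)" "q = vpair y' (vpair \<phi>' \<psi>')"
      "f \<in> chom D y y'" "pact G f (cid E z) \<psi>' = \<psi>" "pact F (cid C x) f \<phi> = \<phi>'"
      and "p \<in> elts (coprod D F G x z)" "q \<in> elts (coprod D F G x z)"
      using pq unfolding R'_gen_def by blast
    then have "\<phi> \<in> elts (pobj F x y)" "\<psi>' \<in> elts (pobj G y' z)" by (auto simp: elts_coprod)
    then have "k y \<phi> (pact G f (cid E z) \<psi>') = k y' (pact F (cid C x) f \<phi>) \<psi>'"
      using k *(3) unfolding balanced_def by blast
    then show ?thesis using * by (simp add: k'_def)
  qed
  have "equivclp (R'_gen C D E F G x z) (vpair y (vpair \<phi> \<psi>)) (vpair y' (vpair \<phi>' \<psi>'))"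
    using eq cls_eq_iff[OF assms(2-7)] by (simp add: R'_def)
  then have "k' (vpair y (vpair \<phi> \<psi>)) = k' (vpair y' (vpair \<phi>' \<psi>'))"
    by (induction rule: equivclp_induct) (auto dest: gen)
  then show ?thesis by (simp add: k'_def)
qed

lemma tensor_lift_cls:
  assumes k: "balanced C D E F G x z k"
    and y: "y \<in> elts (Ob D)" "\<phi> \<in> elts (pobj F x y)" "\<psi> \<in> elts (pobj G y z)"
  shows "tensor_lift C D E F G x z k (cls x z y \<phi> \<psi>) = k y \<phi> \<psi>"
  unfolding tensor_lift_def
proof (rule some_equality)
  show "\<exists>y' \<phi>' \<psi>'. y' \<in> elts (Ob D) \<and> \<phi>' \<in> elts (pobj F x y') \<and> \<psi>' \<in> elts (pobj G y' z) \<and>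
      cls x z y \<phi> \<psi> = cls x z y' \<phi>' \<psi>' \<and> k y \<phi> \<psi> = k y' \<phi>' \<psi>'"
    using y by blast
qed (use balanced_cls_eq[OF k _ _ _ y] in metis)

text \<open>
  The action of \<open>(f, h)\<close> is applied to the two factors separately. It respects the sliding rule
  because the outer actions commute with the action of the middle category.
\<close>

lemma balanced_action:
  assumes f: "f \<in> chom C x' x" and h: "h \<in> chom E z z'"
  shows "balanced C D E F G x z
    (\<lambda>y \<phi> \<psi>. cls x' z' y (pact F f (cid D y) \<phi>) (pact G (cid D y) h \<psi>))"
proof (rule balancedI)
  fix y y' j \<phi> \<psi>
  assume j: "j \<in> chom D y y'" and \<phi>: "\<phi> \<in> elts (pobj F x y)" and \<psi>: "\<psi> \<in> elts (pobj G y' z)"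
  have ob: "x \<in> elts (Ob C)" "x' \<in> elts (Ob C)" "y \<in> elts (Ob D)" "y' \<in> elts (Ob D)"
      "z \<in> elts (Ob E)" "z' \<in> elts (Ob E)"
    using F.C.hom_ob[OF f] F.D.hom_ob[OF j] G.D.hom_ob[OF h] by auto
  have \<phi>': "pact F f (cid D y) \<phi> \<in> elts (pobj F x' y)"
    using F.pact_in[OF f _ \<phi>] ob by simp
  have \<psi>': "pact G (cid D y') h \<psi> \<in> elts (pobj G y' z')"
    using G.pact_in[OF _ h \<psi>] ob by simp
  have "pact G (cid D y) h (pact G j (cid E z) \<psi>) = pact G j (cid E z') (pact G (cid D y') h \<psi>)"
    by (simp add: G.pact_left_right[OF j h \<psi>] G.pact_right_left[OF j h \<psi>])
  moreover have "pact F (cid C x') j (pact F f (cid D y) \<phi>) = pact F f (cid D y') (pact F (cid C x) j \<phi>)"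
    by (simp add: F.pact_left_right[OF f j \<phi>] F.pact_right_left[OF f j \<phi>])
  ultimately show "cls x' z' y (pact F f (cid D y) \<phi>) (pact G (cid D y) h (pact G j (cid E z) \<psi>)) =
      cls x' z' y' (pact F f (cid D y') (pact F (cid C x) j \<phi>)) (pact G (cid D y') h \<psi>)"
    using cls_slide[OF ob(2,6) j \<phi>' \<psi>'] by simp
qed

lemma action_in:
  assumes f: "f \<in> chom C x' x" and h: "h \<in> chom E z z'"
    and y: "y \<in> elts (Ob D)" and \<phi>: "\<phi> \<in> elts (pobj F x y)" and \<psi>: "\<psi> \<in> elts (pobj G y z)"
  shows "pact F f (cid D y) \<phi> \<in> elts (pobj F x' y)" "pact G (cid D y) h \<psi> \<in> elts (pobj G y z')"
  using F.pact_in[OF f F.D.id_hom[OF y] \<phi>] G.pact_in[OF F.D.id_hom[OF y] h \<psi>] by simp_all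

definition action_graph :: "'v \<Rightarrow> 'v \<Rightarrow> 'v"
  where "action_graph f h =
    vset {vpair (cls (ccod C f) (cdom E h) y \<phi> \<psi>)
                (cls (cdom C f) (ccod E h) y (pact F f (cid D y) \<phi>) (pact G (cid D y) h \<psi>)) | y \<phi> \<psi>.
            vpair y (vpair \<phi> \<psi>) \<in> elts (coprod D F G (ccod C f) (cdom E h))}"

text \<open>
  The graph by which the composite acts is written as a set of pairs indexed by representatives.
  It is the graph of a function because the action is balanced.
\<close>

lemma action_graph_eq:
  assumes f: "f \<in> chom C x' x" and h: "h \<in> chom E z z'"
  shows "action_graph f h = vlambda (tensor_obj C D E F G x z) (tensor_lift C D E F G x z
    (\<lambda>y \<phi> \<psi>. cls x' z' y (pact F f (cid D y) \<phi>) (pact G (cid D y) h \<psi>)))"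
proof -
  let ?k = "\<lambda>y \<phi> \<psi>. cls x' z' y (pact F f (cid D y) \<phi>) (pact G (cid D y) h \<psi>)"
  let ?l = "tensor_lift C D E F G x z ?k"
  note lift = tensor_lift_cls[OF balanced_action[OF f h]]
  have "{vpair (cls x z y \<phi> \<psi>) (?k y \<phi> \<psi>) | y \<phi> \<psi>. vpair y (vpair \<phi> \<psi>) \<in> elts (coprod D F G x z)} =
      {vpair c (?l c) | c. c \<in> elts (tensor_obj C D E F G x z)}"
    (is "?A = ?B")
  proof
    show "?A \<subseteq> ?B"
    proof
      fix p assume "p \<in> ?A"
      then obtain y \<phi> \<psi> where p: "p = vpair (cls x z y \<phi> \<psi>) (?k y \<phi> \<psi>)"
        "y \<in> elts (Ob D)" "\<phi> \<in> elts (pobj F x y)" "\<psi> \<in> elts (pobj G y z)"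
        by (auto simp: elts_coprod)
      then have "p = vpair (cls x z y \<phi> \<psi>) (?l (cls x z y \<phi> \<psi>))" by (simp add: lift)
      then show "p \<in> ?B" using cls_in p by blast
    qed
    show "?B \<subseteq> ?A"
    proof
      fix p assume "p \<in> ?B"
      then obtain c where c: "p = vpair c (?l c)" "c \<in> elts (tensor_obj C D E F G x z)" by blast
      obtain y \<phi> \<psi> where y: "c = cls x z y \<phi> \<psi>"
        "y \<in> elts (Ob D)" "\<phi> \<in> elts (pobj F x y)" "\<psi> \<in> elts (pobj G y z)"
        using c(2) by (auto elim: tensor_objE)
      then have "p = vpair (cls x z y \<phi> \<psi>) (?k y \<phi> \<psi>)" using c by (simp add: lift)
      then show "p \<in> ?A" using y elts_coprod by blast
    qed
  qed
  then show ?thesis unfolding action_graph_def vlambda_def using chomD[OF f] chomD[OF h] by simp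
qed

lemma app_action_graph:
  assumes f: "f \<in> chom C x' x" and h: "h \<in> chom E z z'"
    and y: "y \<in> elts (Ob D)" "\<phi> \<in> elts (pobj F x y)" "\<psi> \<in> elts (pobj G y z)"
  shows "app (action_graph f h) (cls x z y \<phi> \<psi>) =
    cls x' z' y (pact F f (cid D y) \<phi>) (pact G (cid D y) h \<psi>)"
  unfolding action_graph_eq[OF f h]
  by (simp add: cls_in[OF y] tensor_lift_cls[OF balanced_action[OF f h] y])

lemma action_graph_vfuns:
  assumes f: "f \<in> chom C x' x" and h: "h \<in> chom E z z'"
  shows "action_graph f h \<in> vfuns (tensor_obj C D E F G x z) (tensor_obj C D E F G x' z')"
  unfolding action_graph_eq[OF f h]
proof (rule vlambda_vfuns)
  fix c assume "c \<in> elts (tensor_obj C D E F G x z)"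
  then obtain y \<phi> \<psi> where y: "y \<in> elts (Ob D)" "\<phi> \<in> elts (pobj F x y)" "\<psi> \<in> elts (pobj G y z)"
    and c: "c = cls x z y \<phi> \<psi>" by (rule tensor_objE)
  show "tensor_lift C D E F G x z
      (\<lambda>y \<phi> \<psi>. cls x' z' y (pact F f (cid D y) \<phi>) (pact G (cid D y) h \<psi>)) c
      \<in> elts (tensor_obj C D E F G x' z')"
    unfolding c tensor_lift_cls[OF balanced_action[OF f h] y]
    by (intro cls_in y(1) action_in[OF f h y])
qed

lemma tensor_prof: "is_prof U C E FG"
  and pobj_tensor: "x \<in> elts (Ob C) \<Longrightarrow> z \<in> elts (Ob E) \<Longrightarrow> pobj FG x z = tensor_obj C D E F G x z"
  and pact_tensor_graph: "f \<in> chom C x' x \<Longrightarrow> h \<in> chom E z z' \<Longrightarrow>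
    pact FG f h c = app (action_graph f h) c"
proof -
  have eq: "FG = mk_functor (prod_cat (op_cat C) E) (\<lambda>a. tensor_obj C D E F G (vfst a) (vsnd a))
    (\<lambda>p. set_arr (tensor_obj C D E F G (ccod C (vfst p)) (cdom E (vsnd p)))
                 (tensor_obj C D E F G (cdom C (vfst p)) (ccod E (vsnd p)))
                 (action_graph (vfst p) (vsnd p)))"
    by (simp add: tensor_def action_graph_def Let_def)
  have k_id: "app (action_graph (cid C x) (cid E z)) c = c"
    if x: "x \<in> elts (Ob C)" and z: "z \<in> elts (Ob E)" and c: "c \<in> elts (tensor_obj C D E F G x z)"
    for x z c
    using c
  proof (rule tensor_objE)
    fix y \<phi> \<psi> assume y: "y \<in> elts (Ob D)" "\<phi> \<in> elts (pobj F x y)" "\<psi> \<in> elts (pobj G y z)"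
      and [simp]: "c = cls x z y \<phi> \<psi>"
    show ?thesis
      using x y z app_action_graph[OF F.C.id_hom[OF x] G.D.id_hom[OF z] y]
      by (simp add: F.pact_id G.pact_id)
  qed
  have k_comp: "app (action_graph f' h') (app (action_graph f h) c) =
      app (action_graph (ccomp C f f') (ccomp E h' h)) c"
    if f: "f \<in> chom C x' x" and h: "h \<in> chom E z z'" and f': "f' \<in> chom C x'' x'"
      and h': "h' \<in> chom E z' z''" and c: "c \<in> elts (tensor_obj C D E F G x z)"
    for x x' x'' z z' z'' f f' h h' c
    using c
  proof (rule tensor_objE)
    fix y \<phi> \<psi> assume y: "y \<in> elts (Ob D)" "\<phi> \<in> elts (pobj F x y)" "\<psi> \<in> elts (pobj G y z)"
      and c: "c = cls x z y \<phi> \<psi>"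
    show ?thesis unfolding c app_action_graph[OF f h y]
        app_action_graph[OF f' h' y(1) action_in[OF f h y]]
        app_action_graph[OF F.C.comp_hom[OF f' f] G.D.comp_hom[OF h h'] y]
        F.pact_comp_left[OF f f' y(1,2)] G.pact_comp_right[OF h h' y(1,3)] ..
  qed
  note mk = F.prof_mk_functor[of C E "tensor_obj C D E F G" action_graph, folded eq,
      OF F.C.category G.D.category tensor_obj_in action_graph_vfuns k_id k_comp]
  show "is_prof U C E FG" by (rule mk(1))
  show "x \<in> elts (Ob C) \<Longrightarrow> z \<in> elts (Ob E) \<Longrightarrow> pobj FG x z = tensor_obj C D E F G x z"
    by (rule mk(2))
  show "f \<in> chom C x' x \<Longrightarrow> h \<in> chom E z z' \<Longrightarrow> pact FG f h c = app (action_graph f h) c"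
    by (rule mk(3))
qed

lemma pact_tensor:
  assumes f: "f \<in> chom C x' x" and h: "h \<in> chom E z z'"
    and y: "y \<in> elts (Ob D)" "\<phi> \<in> elts (pobj F x y)" "\<psi> \<in> elts (pobj G y z)"
  shows "pact FG f h (cls x z y \<phi> \<psi>) =
    cls x' z' y (pact F f (cid D y) \<phi>) (pact G (cid D y) h \<psi>)"
  using app_action_graph[OF assms] pact_tensor_graph[OF f h] by simp

lemma cls_in_pobj: "x \<in> elts (Ob C) \<Longrightarrow> z \<in> elts (Ob E) \<Longrightarrow> y \<in> elts (Ob D) \<Longrightarrow>
    \<phi> \<in> elts (pobj F x y) \<Longrightarrow> \<psi> \<in> elts (pobj G y z) \<Longrightarrow> cls x z y \<phi> \<psi> \<in> elts (pobj FG x z)"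
  by (simp add: pobj_tensor cls_in)

lemma pobj_tensorE:
  assumes "c \<in> elts (pobj FG x z)" "x \<in> elts (Ob C)" "z \<in> elts (Ob E)"
  obtains y \<phi> \<psi> where "y \<in> elts (Ob D)" "\<phi> \<in> elts (pobj F x y)" "\<psi> \<in> elts (pobj G y z)"
    "c = cls x z y \<phi> \<psi>"
  using assms by (auto simp: pobj_tensor elim: tensor_objE)

text \<open>
  All coherence isomorphisms have a composite as their source, so each is given by a balanced
  family \<open>k\<close>. Surjectivity can be read off from \<open>k\<close>, and for injectivity it is enough to recover
  the class of a triple from its image under \<open>k\<close>.
\<close>

lemma tensor_isoI:
  assumes bal: "\<And>x z. x \<in> elts (Ob C) \<Longrightarrow> z \<in> elts (Ob E) \<Longrightarrow> balanced C D E F G x z (k x z)"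
    and k_in: "\<And>x y z \<phi> \<psi>. x \<in> elts (Ob C) \<Longrightarrow> y \<in> elts (Ob D) \<Longrightarrow> z \<in> elts (Ob E) \<Longrightarrow>
      \<phi> \<in> elts (pobj F x y) \<Longrightarrow> \<psi> \<in> elts (pobj G y z) \<Longrightarrow> k x z y \<phi> \<psi> \<in> elts (pobj H x z)"
    and surj: "\<And>x z b. x \<in> elts (Ob C) \<Longrightarrow> z \<in> elts (Ob E) \<Longrightarrow> b \<in> elts (pobj H x z) \<Longrightarrow>
      \<exists>y\<in>elts (Ob D). \<exists>\<phi>\<in>elts (pobj F x y). \<exists>\<psi>\<in>elts (pobj G y z). b = k x z y \<phi> \<psi>"
    and inj: "\<And>x y z \<phi> \<psi>. x \<in> elts (Ob C) \<Longrightarrow> y \<in> elts (Ob D) \<Longrightarrow> z \<in> elts (Ob E) \<Longrightarrow>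
      \<phi> \<in> elts (pobj F x y) \<Longrightarrow> \<psi> \<in> elts (pobj G y z) \<Longrightarrow> j x z (k x z y \<phi> \<psi>) = cls x z y \<phi> \<psi>"
    and nat: "\<And>x x' y z z' f h \<phi> \<psi>. f \<in> chom C x' x \<Longrightarrow> h \<in> chom E z z' \<Longrightarrow> y \<in> elts (Ob D) \<Longrightarrow>
      \<phi> \<in> elts (pobj F x y) \<Longrightarrow> \<psi> \<in> elts (pobj G y z) \<Longrightarrow>
      k x' z' y (pact F f (cid D y) \<phi>) (pact G (cid D y) h \<psi>) = pact H f h (k x z y \<phi> \<psi>)"
  shows "\<exists>\<theta>. prof_iso C E FG H \<theta> \<and>
    (\<forall>x y z \<phi> \<psi>. x \<in> elts (Ob C) \<longrightarrow> y \<in> elts (Ob D) \<longrightarrow> z \<in> elts (Ob E) \<longrightarrow>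
      \<phi> \<in> elts (pobj F x y) \<longrightarrow> \<psi> \<in> elts (pobj G y z) \<longrightarrow> \<theta> x z (cls x z y \<phi> \<psi>) = k x z y \<phi> \<psi>)"
proof -
  define \<theta> where "\<theta> x z = tensor_lift C D E F G x z (k x z)" for x z
  have \<theta>: "\<theta> x z (cls x z y \<phi> \<psi>) = k x z y \<phi> \<psi>"
    if "x \<in> elts (Ob C)" "z \<in> elts (Ob E)" "y \<in> elts (Ob D)" "\<phi> \<in> elts (pobj F x y)" "\<psi> \<in> elts (pobj G y z)"
    for x y z \<phi> \<psi>
    using that by (simp add: \<theta>_def tensor_lift_cls[OF bal])
  have "bij_betw (\<theta> x z) (elts (pobj FG x z)) (elts (pobj H x z))"
    if x: "x \<in> elts (Ob C)" and z: "z \<in> elts (Ob E)" for x z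
  proof (rule bij_betw_imageI)
    show "inj_on (\<theta> x z) (elts (pobj FG x z))"
    proof (rule inj_on_inverseI)
      fix c assume "c \<in> elts (pobj FG x z)"
      then show "j x z (\<theta> x z c) = c"
        using x z by (auto elim!: pobj_tensorE simp: \<theta> inj)
    qed
    show "\<theta> x z ` elts (pobj FG x z) = elts (pobj H x z)"
    proof
      show "\<theta> x z ` elts (pobj FG x z) \<subseteq> elts (pobj H x z)"
        using x z by (auto elim!: pobj_tensorE simp: \<theta> k_in)
      show "elts (pobj H x z) \<subseteq> \<theta> x z ` elts (pobj FG x z)"
      proof
        fix b assume "b \<in> elts (pobj H x z)"
        then obtain y \<phi> \<psi> where y: "y \<in> elts (Ob D)" "\<phi> \<in> elts (pobj F x y)" "\<psi> \<in> elts (pobj G y z)"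
          "b = k x z y \<phi> \<psi>" using surj[OF x z] by blast
        then have "b = \<theta> x z (cls x z y \<phi> \<psi>)" using x z by (simp add: \<theta>)
        then show "b \<in> \<theta> x z ` elts (pobj FG x z)" using cls_in_pobj[OF x z y(1-3)] by blast
      qed
    qed
  qed
  moreover have "\<theta> x' z' (pact FG f h c) = pact H f h (\<theta> x z c)"
    if f: "f \<in> chom C x' x" and h: "h \<in> chom E z z'" and c: "c \<in> elts (pobj FG x z)"
    for x x' z z' f h c
  proof -
    have ob: "x \<in> elts (Ob C)" "x' \<in> elts (Ob C)" "z \<in> elts (Ob E)" "z' \<in> elts (Ob E)"
      using F.C.hom_ob[OF f] G.D.hom_ob[OF h] by auto
    obtain y \<phi> \<psi> where y: "y \<in> elts (Ob D)" "\<phi> \<in> elts (pobj F x y)" "\<psi> \<in> elts (pobj G y z)"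
      and [simp]: "c = cls x z y \<phi> \<psi>" using c ob(1,3) by (rule pobj_tensorE)
    show ?thesis
      by (simp add: pact_tensor[OF f h y] \<theta> ob y action_in[OF f h y] nat[OF f h y])
  qed
  ultimately show ?thesis unfolding prof_iso_def using \<theta> by blast
qed

end

section \<open>Coherence isomorphisms\<close>

text \<open>
  Composition is functorial in both factors: \<open>\<alpha>\<close> and \<open>\<beta>\<close> act on the two entries of a triple, which is
  balanced by their naturality, and their inverses give the inverse. This makes the composite of
  two isomorphism classes independent of the representatives.
\<close>

lemma tensor_cong:
  assumes FG: "composable U C D E F G" and FG': "composable U C D E F' G'"
    and \<alpha>: "prof_iso C D F F' \<alpha>" and \<beta>: "prof_iso D E G G' \<beta>"
  shows "\<exists>\<theta>. prof_iso C E (tensor C D E F G) (tensor C D E F' G') \<theta> \<and>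
    (\<forall>x y z \<phi> \<psi>. x \<in> elts (Ob C) \<longrightarrow> y \<in> elts (Ob D) \<longrightarrow> z \<in> elts (Ob E) \<longrightarrow>
      \<phi> \<in> elts (pobj F x y) \<longrightarrow> \<psi> \<in> elts (pobj G y z) \<longrightarrow>
      \<theta> x z (tensor_class C D E F G x z y \<phi> \<psi>) =
        tensor_class C D E F' G' x z y (\<alpha> x y \<phi>) (\<beta> y z \<psi>))"
proof -
  interpret FG: composable U C D E F G by (rule FG)
  interpret FG': composable U C D E F' G' by (rule FG')
  interpret FF': two_profunctors U C D F F' ..
  interpret GG': two_profunctors U D E G G' ..
  note \<alpha>_in = prof_iso_in[OF \<alpha>] and \<beta>_in = prof_iso_in[OF \<beta>]
  obtain \<alpha>' where \<alpha>': "prof_iso C D F' F \<alpha>'"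
    and \<alpha>'\<alpha>: "\<And>x y a. x \<in> elts (Ob C) \<Longrightarrow> y \<in> elts (Ob D) \<Longrightarrow> a \<in> elts (pobj F x y) \<Longrightarrow> \<alpha>' x y (\<alpha> x y a) = a"
    and \<alpha>\<alpha>': "\<And>x y a. x \<in> elts (Ob C) \<Longrightarrow> y \<in> elts (Ob D) \<Longrightarrow> a \<in> elts (pobj F' x y) \<Longrightarrow> \<alpha> x y (\<alpha>' x y a) = a"
    by (rule FF'.prof_iso_sym[OF \<alpha>]) blast
  obtain \<beta>' where \<beta>': "prof_iso D E G' G \<beta>'"
    and \<beta>'\<beta>: "\<And>x y a. x \<in> elts (Ob D) \<Longrightarrow> y \<in> elts (Ob E) \<Longrightarrow> a \<in> elts (pobj G x y) \<Longrightarrow> \<beta>' x y (\<beta> x y a) = a"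
    and \<beta>\<beta>': "\<And>x y a. x \<in> elts (Ob D) \<Longrightarrow> y \<in> elts (Ob E) \<Longrightarrow> a \<in> elts (pobj G' x y) \<Longrightarrow> \<beta> x y (\<beta>' x y a) = a"
    by (rule GG'.prof_iso_sym[OF \<beta>]) blast
  note \<alpha>'_in = prof_iso_in[OF \<alpha>'] and \<beta>'_in = prof_iso_in[OF \<beta>']
  have bal: "balanced C D E F G x z (\<lambda>y \<phi> \<psi>. FG'.cls x z y (\<alpha> x y \<phi>) (\<beta> y z \<psi>))"
    if x: "x \<in> elts (Ob C)" and z: "z \<in> elts (Ob E)" for x z
  proof (rule balancedI)
    fix y y' f \<phi> \<psi>
    assume f: "f \<in> chom D y y'" and \<phi>: "\<phi> \<in> elts (pobj F x y)" and \<psi>: "\<psi> \<in> elts (pobj G y' z)"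
    show "FG'.cls x z y (\<alpha> x y \<phi>) (\<beta> y z (pact G f (cid E z) \<psi>)) =
        FG'.cls x z y' (\<alpha> x y' (pact F (cid C x) f \<phi>)) (\<beta> y' z \<psi>)"
      using FG'.cls_slide[OF x z f] FG.F.D.hom_ob[OF f] x z \<phi> \<psi>
      by (simp add: prof_iso_nat[OF \<alpha> FG.F.C.id_hom[OF x] f \<phi>]
          prof_iso_nat[OF \<beta> f FG.G.D.id_hom[OF z] \<psi>] \<alpha>_in \<beta>_in)
  qed
  have bal': "balanced C D E F' G' x z (\<lambda>y \<phi> \<psi>. FG.cls x z y (\<alpha>' x y \<phi>) (\<beta>' y z \<psi>))"
    if x: "x \<in> elts (Ob C)" and z: "z \<in> elts (Ob E)" for x z
  proof (rule balancedI)
    fix y y' f \<phi> \<psi>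
    assume f: "f \<in> chom D y y'" and \<phi>: "\<phi> \<in> elts (pobj F' x y)" and \<psi>: "\<psi> \<in> elts (pobj G' y' z)"
    show "FG.cls x z y (\<alpha>' x y \<phi>) (\<beta>' y z (pact G' f (cid E z) \<psi>)) =
        FG.cls x z y' (\<alpha>' x y' (pact F' (cid C x) f \<phi>)) (\<beta>' y' z \<psi>)"
      using FG.cls_slide[OF x z f] FG.F.D.hom_ob[OF f] x z \<phi> \<psi>
      by (simp add: prof_iso_nat[OF \<alpha>' FG.F.C.id_hom[OF x] f \<phi>]
          prof_iso_nat[OF \<beta>' f FG.G.D.id_hom[OF z] \<psi>] \<alpha>'_in \<beta>'_in)
  qed
  show ?thesis
  proof (rule FG.tensor_isoI[where k = "\<lambda>x z y \<phi> \<psi>. FG'.cls x z y (\<alpha> x y \<phi>) (\<beta> y z \<psi>)"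
        and j = "\<lambda>x z. tensor_lift C D E F' G' x z (\<lambda>y \<phi> \<psi>. FG.cls x z y (\<alpha>' x y \<phi>) (\<beta>' y z \<psi>))"])
    fix x z b assume x: "x \<in> elts (Ob C)" and z: "z \<in> elts (Ob E)" and b: "b \<in> elts (pobj FG'.FG x z)"
    obtain y \<phi> \<psi> where y: "y \<in> elts (Ob D)" "\<phi> \<in> elts (pobj F' x y)" "\<psi> \<in> elts (pobj G' y z)"
      and "b = FG'.cls x z y \<phi> \<psi>" using b x z by (rule FG'.pobj_tensorE)
    then have "b = FG'.cls x z y (\<alpha> x y (\<alpha>' x y \<phi>)) (\<beta> y z (\<beta>' y z \<psi>))"
      using x z by (simp add: \<alpha>\<alpha>' \<beta>\<beta>')
    then show "\<exists>y\<in>elts (Ob D). \<exists>\<phi>\<in>elts (pobj F x y). \<exists>\<psi>\<in>elts (pobj G y z).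
        b = FG'.cls x z y (\<alpha> x y \<phi>) (\<beta> y z \<psi>)"
      using y \<alpha>'_in[OF x y(1,2)] \<beta>'_in[OF y(1) z y(3)] by blast
  next
    fix x x' y z z' f h \<phi> \<psi>
    assume f: "f \<in> chom C x' x" and h: "h \<in> chom E z z'"
      and y: "y \<in> elts (Ob D)" "\<phi> \<in> elts (pobj F x y)" "\<psi> \<in> elts (pobj G y z)"
    have ob: "x \<in> elts (Ob C)" "z \<in> elts (Ob E)"
      using FG.F.C.hom_ob[OF f] FG.G.D.hom_ob[OF h] by auto
    show "FG'.cls x' z' y (\<alpha> x' y (pact F f (cid D y) \<phi>)) (\<beta> y z' (pact G (cid D y) h \<psi>)) =
        pact FG'.FG f h (FG'.cls x z y (\<alpha> x y \<phi>) (\<beta> y z \<psi>))"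
      by (simp add: FG'.pact_tensor[OF f h y(1) \<alpha>_in[OF ob(1) y(1,2)] \<beta>_in[OF y(1) ob(2) y(3)]]
          prof_iso_nat[OF \<alpha> f FG.F.D.id_hom[OF y(1)] y(2)]
          prof_iso_nat[OF \<beta> FG.F.D.id_hom[OF y(1)] h y(3)])
  qed (simp_all add: bal FG'.cls_in_pobj \<alpha>_in \<beta>_in FG'.tensor_lift_cls[OF bal'] \<alpha>'\<alpha> \<beta>'\<beta>)
qed

text \<open>
  The map \<open>[[\<phi>, \<psi>], \<chi>] \<mapsto> [\<phi>, [\<psi>, \<chi>]]\<close>. Both sides are quotients of the same triples, and each
  rebracketing respects the sliding rules in either middle category. A bracketing consists of two
  nested quotients, so each rebracketing is descended in two steps: first over the inner quotient
  (the maps \<open>a\<close> and \<open>b\<close> below), then over the outer one.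
\<close>

lemma tensor_assoc:
  assumes FG: "composable U B C D F G" and GH: "composable U C D E G H"
  shows "\<exists>\<theta>. prof_iso B E (tensor B D E (tensor B C D F G) H) (tensor B C E F (tensor C D E G H)) \<theta> \<and>
    (\<forall>w x y z \<phi> \<psi> \<chi>. w \<in> elts (Ob B) \<longrightarrow> x \<in> elts (Ob C) \<longrightarrow> y \<in> elts (Ob D) \<longrightarrow> z \<in> elts (Ob E) \<longrightarrow>
      \<phi> \<in> elts (pobj F w x) \<longrightarrow> \<psi> \<in> elts (pobj G x y) \<longrightarrow> \<chi> \<in> elts (pobj H y z) \<longrightarrow>
      \<theta> w z (tensor_class B D E (tensor B C D F G) H w z y (tensor_class B C D F G w y x \<phi> \<psi>) \<chi>) =
        tensor_class B C E F (tensor C D E G H) w z x \<phi> (tensor_class C D E G H x z y \<psi> \<chi>))"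
proof -
  interpret FG: composable U B C D F G by (rule FG)
  interpret GH: composable U C D E G H by (rule GH)
  interpret L: composable U B D E FG.FG H
    by unfold_locales (rule FG.tensor_prof, rule GH.Ob_D)
  interpret R: composable U B C E F GH.FG
    by unfold_locales (rule GH.tensor_prof, rule FG.Ob_D)
  define a where "a w z y \<chi> =
    tensor_lift B C D F G w y (\<lambda>x \<phi> \<psi>. R.cls w z x \<phi> (GH.cls x z y \<psi> \<chi>))" for w z y \<chi>
  define b where "b w z x \<phi> =
    tensor_lift C D E G H x z (\<lambda>y \<psi> \<chi>. L.cls w z y (FG.cls w y x \<phi> \<psi>) \<chi>)" for w z x \<phi>

  have a: "a w z y \<chi> (FG.cls w y x \<phi> \<psi>) = R.cls w z x \<phi> (GH.cls x z y \<psi> \<chi>)"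
    if w: "w \<in> elts (Ob B)" and y: "y \<in> elts (Ob D)" and z: "z \<in> elts (Ob E)"
      and \<chi>: "\<chi> \<in> elts (pobj H y z)"
      and x: "x \<in> elts (Ob C)" "\<phi> \<in> elts (pobj F w x)" "\<psi> \<in> elts (pobj G x y)"
    for w x y z \<phi> \<psi> \<chi>
    unfolding a_def
  proof (rule FG.tensor_lift_cls[OF _ x], rule balancedI)
    fix x x' f \<phi> \<psi>
    assume f: "f \<in> chom C x x'" and \<phi>: "\<phi> \<in> elts (pobj F w x)" and \<psi>: "\<psi> \<in> elts (pobj G x' y)"
    have x': "x' \<in> elts (Ob C)" using FG.F.D.hom_ob[OF f] by blast
    have "GH.cls x z y (pact G f (cid D y) \<psi>) \<chi> = pact GH.FG f (cid E z) (GH.cls x' z y \<psi> \<chi>)"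
      by (simp add: GH.pact_tensor[OF f GH.G.D.id_hom[OF z] y \<psi> \<chi>] GH.G.pact_id[OF y z \<chi>])
    then show "R.cls w z x \<phi> (GH.cls x z y (pact G f (cid D y) \<psi>) \<chi>) =
        R.cls w z x' (pact F (cid B w) f \<phi>) (GH.cls x' z y \<psi> \<chi>)"
      by (simp add: R.cls_slide[OF w z f \<phi> GH.cls_in_pobj[OF x' z y \<psi> \<chi>]])
  qed
  have b: "b w z x \<phi> (GH.cls x z y \<psi> \<chi>) = L.cls w z y (FG.cls w y x \<phi> \<psi>) \<chi>"
    if w: "w \<in> elts (Ob B)" and x: "x \<in> elts (Ob C)" and z: "z \<in> elts (Ob E)"
      and \<phi>: "\<phi> \<in> elts (pobj F w x)"
      and y: "y \<in> elts (Ob D)" "\<psi> \<in> elts (pobj G x y)" "\<chi> \<in> elts (pobj H y z)"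
    for w x y z \<phi> \<psi> \<chi>
    unfolding b_def
  proof (rule GH.tensor_lift_cls[OF _ y], rule balancedI)
    fix y y' f \<psi> \<chi>
    assume f: "f \<in> chom D y y'" and \<psi>: "\<psi> \<in> elts (pobj G x y)" and \<chi>: "\<chi> \<in> elts (pobj H y' z)"
    have y: "y \<in> elts (Ob D)" using FG.G.D.hom_ob[OF f] by blast
    have "FG.cls w y' x \<phi> (pact G (cid C x) f \<psi>) = pact FG.FG (cid B w) f (FG.cls w y x \<phi> \<psi>)"
      by (simp add: FG.pact_tensor[OF FG.F.C.id_hom[OF w] f x \<phi> \<psi>] FG.F.pact_id[OF w x \<phi>])
    then show "L.cls w z y (FG.cls w y x \<phi> \<psi>) (pact H f (cid E z) \<chi>) =
        L.cls w z y' (FG.cls w y' x \<phi> (pact G (cid C x) f \<psi>)) \<chi>"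
      by (simp add: L.cls_slide[OF w z f FG.cls_in_pobj[OF w y x \<phi> \<psi>] \<chi>])
  qed

  have bal_a: "balanced B D E FG.FG H w z (\<lambda>y c \<chi>. a w z y \<chi> c)"
    if w: "w \<in> elts (Ob B)" and z: "z \<in> elts (Ob E)" for w z
  proof (rule balancedI)
    fix y y' f c \<chi>
    assume f: "f \<in> chom D y y'" and c: "c \<in> elts (pobj FG.FG w y)" and \<chi>: "\<chi> \<in> elts (pobj H y' z)"
    have ob: "y \<in> elts (Ob D)" "y' \<in> elts (Ob D)" using FG.G.D.hom_ob[OF f] by auto
    obtain x \<phi> \<psi> where x: "x \<in> elts (Ob C)" "\<phi> \<in> elts (pobj F w x)" "\<psi> \<in> elts (pobj G x y)"
      and c: "c = FG.cls w y x \<phi> \<psi>" using c w ob(1) by (rule FG.pobj_tensorE)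
    have \<chi>': "pact H f (cid E z) \<chi> \<in> elts (pobj H y z)"
      by (rule GH.G.pact_in[OF f GH.G.D.id_hom[OF z] \<chi>])
    have \<psi>': "pact G (cid C x) f \<psi> \<in> elts (pobj G x y')"
      by (rule FG.G.pact_in[OF FG.F.D.id_hom[OF x(1)] f x(3)])
    have "pact FG.FG (cid B w) f c = FG.cls w y' x \<phi> (pact G (cid C x) f \<psi>)"
      unfolding c by (simp add: FG.pact_tensor[OF FG.F.C.id_hom[OF w] f x] FG.F.pact_id[OF w x(1,2)])
    then show "a w z y (pact H f (cid E z) \<chi>) c = a w z y' \<chi> (pact FG.FG (cid B w) f c)"
      by (simp add: c a w z ob x \<chi> \<chi>' \<psi>' GH.cls_slide[OF x(1) z f x(3) \<chi>])
  qed
  have bal_b: "balanced B C E F GH.FG w z (\<lambda>x \<phi> d. b w z x \<phi> d)"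
    if w: "w \<in> elts (Ob B)" and z: "z \<in> elts (Ob E)" for w z
  proof (rule balancedI)
    fix x x' f \<phi> d
    assume f: "f \<in> chom C x x'" and \<phi>: "\<phi> \<in> elts (pobj F w x)" and d: "d \<in> elts (pobj GH.FG x' z)"
    have ob: "x \<in> elts (Ob C)" "x' \<in> elts (Ob C)" using FG.F.D.hom_ob[OF f] by auto
    obtain y \<psi> \<chi> where y: "y \<in> elts (Ob D)" "\<psi> \<in> elts (pobj G x' y)" "\<chi> \<in> elts (pobj H y z)"
      and d: "d = GH.cls x' z y \<psi> \<chi>" using d ob(2) z by (rule GH.pobj_tensorE)
    have \<phi>': "pact F (cid B w) f \<phi> \<in> elts (pobj F w x')"
      by (rule FG.F.pact_in[OF FG.F.C.id_hom[OF w] f \<phi>])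
    have \<psi>': "pact G f (cid D y) \<psi> \<in> elts (pobj G x y)"
      by (rule FG.G.pact_in[OF f FG.G.D.id_hom[OF y(1)] y(2)])
    have "pact GH.FG f (cid E z) d = GH.cls x z y (pact G f (cid D y) \<psi>) \<chi>"
      unfolding d by (simp add: GH.pact_tensor[OF f GH.G.D.id_hom[OF z] y] GH.G.pact_id[OF y(1) z y(3)])
    then show "b w z x \<phi> (pact GH.FG f (cid E z) d) = b w z x' (pact F (cid B w) f \<phi>) d"
      by (simp add: d b w z ob y \<phi> \<phi>' \<psi>' FG.cls_slide[OF w y(1) f \<phi> y(2)])
  qed

  have "\<exists>\<theta>. prof_iso B E L.FG R.FG \<theta> \<and>
    (\<forall>w y z c \<chi>. w \<in> elts (Ob B) \<longrightarrow> y \<in> elts (Ob D) \<longrightarrow> z \<in> elts (Ob E) \<longrightarrow>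
      c \<in> elts (pobj FG.FG w y) \<longrightarrow> \<chi> \<in> elts (pobj H y z) \<longrightarrow> \<theta> w z (L.cls w z y c \<chi>) = a w z y \<chi> c)"
  proof (rule L.tensor_isoI[where j = "\<lambda>w z. tensor_lift B C E F GH.FG w z (\<lambda>x \<phi> d. b w z x \<phi> d)"])
    fix w z assume w: "w \<in> elts (Ob B)" and z: "z \<in> elts (Ob E)"
    show "balanced B D E FG.FG H w z (\<lambda>y c \<chi>. a w z y \<chi> c)" by (rule bal_a[OF w z])
  next
    fix w y z c \<chi>
    assume w: "w \<in> elts (Ob B)" and y: "y \<in> elts (Ob D)" and z: "z \<in> elts (Ob E)"
      and c: "c \<in> elts (pobj FG.FG w y)" and \<chi>: "\<chi> \<in> elts (pobj H y z)"
    obtain x \<phi> \<psi> where x: "x \<in> elts (Ob C)" "\<phi> \<in> elts (pobj F w x)" "\<psi> \<in> elts (pobj G x y)"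
      and c: "c = FG.cls w y x \<phi> \<psi>" using c w y by (rule FG.pobj_tensorE)
    have d: "GH.cls x z y \<psi> \<chi> \<in> elts (pobj GH.FG x z)" by (rule GH.cls_in_pobj[OF x(1) z y x(3) \<chi>])
    show "a w z y \<chi> c \<in> elts (pobj R.FG w z)"
      by (simp add: c a w y z x \<chi> R.cls_in_pobj d)
    show "tensor_lift B C E F GH.FG w z (\<lambda>x \<phi> d. b w z x \<phi> d) (a w z y \<chi> c) = L.cls w z y c \<chi>"
      by (simp add: c a w y z x \<chi> R.tensor_lift_cls[OF bal_b[OF w z]] d b)
  next
    fix w z e assume w: "w \<in> elts (Ob B)" and z: "z \<in> elts (Ob E)" and e: "e \<in> elts (pobj R.FG w z)"
    obtain x \<phi> d where x: "x \<in> elts (Ob C)" "\<phi> \<in> elts (pobj F w x)" and d: "d \<in> elts (pobj GH.FG x z)"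
      and e: "e = R.cls w z x \<phi> d" using e w z by (rule R.pobj_tensorE)
    obtain y \<psi> \<chi> where y: "y \<in> elts (Ob D)" "\<psi> \<in> elts (pobj G x y)" "\<chi> \<in> elts (pobj H y z)"
      and d: "d = GH.cls x z y \<psi> \<chi>" using d x(1) z by (rule GH.pobj_tensorE)
    have "e = a w z y \<chi> (FG.cls w y x \<phi> \<psi>)" by (simp add: e d a w x y z)
    then show "\<exists>y\<in>elts (Ob D). \<exists>c\<in>elts (pobj FG.FG w y). \<exists>\<chi>\<in>elts (pobj H y z). e = a w z y \<chi> c"
      using y FG.cls_in_pobj[OF w y(1) x y(2)] by blast
  next
    fix w w' y z z' f h c \<chi>
    assume f: "f \<in> chom B w' w" and h: "h \<in> chom E z z'" and y: "y \<in> elts (Ob D)"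
      and c: "c \<in> elts (pobj FG.FG w y)" and \<chi>: "\<chi> \<in> elts (pobj H y z)"
    have ob: "w \<in> elts (Ob B)" "w' \<in> elts (Ob B)" "z \<in> elts (Ob E)" "z' \<in> elts (Ob E)"
      using FG.F.C.hom_ob[OF f] GH.G.D.hom_ob[OF h] by auto
    obtain x \<phi> \<psi> where x: "x \<in> elts (Ob C)" "\<phi> \<in> elts (pobj F w x)" "\<psi> \<in> elts (pobj G x y)"
      and c: "c = FG.cls w y x \<phi> \<psi>" using c ob(1) y by (rule FG.pobj_tensorE)
    have in': "pact F f (cid C x) \<phi> \<in> elts (pobj F w' x)" "pact H (cid D y) h \<chi> \<in> elts (pobj H y z')"
      using FG.F.pact_in[OF f FG.F.D.id_hom[OF x(1)] x(2)]
        GH.G.pact_in[OF FG.G.D.id_hom[OF y] h \<chi>] by simp_all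
    have "pact FG.FG f (cid D y) c = FG.cls w' y x (pact F f (cid C x) \<phi>) \<psi>"
      unfolding c by (simp add: FG.pact_tensor[OF f FG.G.D.id_hom[OF y] x] FG.G.pact_id[OF x(1) y x(3)])
    moreover have "pact GH.FG (cid C x) h (GH.cls x z y \<psi> \<chi>) =
        GH.cls x z' y \<psi> (pact H (cid D y) h \<chi>)"
      by (simp add: GH.pact_tensor[OF FG.F.D.id_hom[OF x(1)] h y x(3) \<chi>] FG.G.pact_id[OF x(1) y x(3)])
    moreover have "GH.cls x z y \<psi> \<chi> \<in> elts (pobj GH.FG x z)"
      by (rule GH.cls_in_pobj[OF x(1) ob(3) y x(3) \<chi>])
    ultimately show "a w' z' y (pact H (cid D y) h \<chi>) (pact FG.FG f (cid D y) c) =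
        pact R.FG f h (a w z y \<chi> c)"
      by (simp add: c a ob y x \<chi> in' R.pact_tensor[OF f h x(1,2)])
  qed
  then obtain \<theta> where "prof_iso B E L.FG R.FG \<theta>"
    and \<theta>: "\<And>w y z c \<chi>. w \<in> elts (Ob B) \<Longrightarrow> y \<in> elts (Ob D) \<Longrightarrow> z \<in> elts (Ob E) \<Longrightarrow>
      c \<in> elts (pobj FG.FG w y) \<Longrightarrow> \<chi> \<in> elts (pobj H y z) \<Longrightarrow> \<theta> w z (L.cls w z y c \<chi>) = a w z y \<chi> c"
    by metis
  then show ?thesis using FG.cls_in_pobj a by (intro exI[of _ \<theta>]) simp
qed

lemma (in universe) hom_prof:
  fixes C :: 'v
  assumes C: "is_category C" and Arr: "Arr C \<in> elts U"
  shows "is_prof U C C (hom_functor C)"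
    and "x \<in> elts (Ob C) \<Longrightarrow> y \<in> elts (Ob C) \<Longrightarrow>
      pobj (hom_functor C) x y = vset (chom C x y)"
    and "f \<in> chom C x' x \<Longrightarrow> g \<in> chom C y y' \<Longrightarrow> h \<in> chom C x y \<Longrightarrow>
      pact (hom_functor C) f g h = ccomp C g (ccomp C h f)"
proof -
  interpret C: category C by unfold_locales (rule C)
  define k where "k f g =
    vlambda (vset (chom C (ccod C f) (cdom C g))) (\<lambda>h. ccomp C g (ccomp C h f))" for f g
  have eq: "hom_functor C = mk_functor (prod_cat (op_cat C) C) (\<lambda>a. vset (chom C (vfst a) (vsnd a)))
    (\<lambda>p. set_arr (vset (chom C (ccod C (vfst p)) (cdom C (vsnd p))))
                 (vset (chom C (cdom C (vfst p)) (ccod C (vsnd p)))) (k (vfst p) (vsnd p)))"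
    by (simp add: hom_functor_def k_def Let_def)
  have k: "k f g = vlambda (vset (chom C x y)) (\<lambda>h. ccomp C g (ccomp C h f))"
    if "f \<in> chom C x' x" "g \<in> chom C y y'" for f g x x' y y'
    using chomD[OF that(1)] chomD[OF that(2)] by (simp add: k_def)
  have hom_in: "vset (chom C x y) \<in> elts U" for x y
    using vset_subset_in[OF Arr, of "chom C x y"] by (auto simp: chom_def)
  have k_fun: "k f g \<in> vfuns (vset (chom C x y)) (vset (chom C x' y'))"
    if f: "f \<in> chom C x' x" and g: "g \<in> chom C y y'" for f g x x' y y'
    unfolding k[OF f g] by (rule vlambda_vfuns) (simp add: C.comp_hom[OF C.comp_hom[OF f] g])
  have k_id: "app (k (cid C x) (cid C y)) h = h"
    if "x \<in> elts (Ob C)" "y \<in> elts (Ob C)" "h \<in> elts (vset (chom C x y))" for x y h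
    using that by (simp add: k[OF C.id_hom C.id_hom] C.comp_id C.id_comp)
  have k_comp: "app (k f' g') (app (k f g) h) = app (k (ccomp C f f') (ccomp C g' g)) h"
    if f: "f \<in> chom C x' x" and g: "g \<in> chom C y y'" and f': "f' \<in> chom C x'' x'"
      and g': "g' \<in> chom C y' y''" and h: "h \<in> elts (vset (chom C x y))"
    for x x' x'' y y' y'' f f' g g' h
  proof -
    have h: "h \<in> chom C x y" using h by simp
    have hf: "ccomp C h f \<in> chom C x' y" by (rule C.comp_hom[OF f h])
    have ghf: "ccomp C g (ccomp C h f) \<in> chom C x' y'" by (rule C.comp_hom[OF hf g])
    have "ccomp C g' (ccomp C (ccomp C g (ccomp C h f)) f') =
        ccomp C g' (ccomp C g (ccomp C (ccomp C h f) f'))"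
      by (simp add: C.comp_assoc[OF f' hf g])
    also have "\<dots> = ccomp C (ccomp C g' g) (ccomp C h (ccomp C f f'))"
      by (simp add: C.comp_assoc[OF C.comp_hom[OF f' hf] g g'] C.comp_assoc[OF f' f h])
    finally show ?thesis
      by (simp add: k[OF f g] k[OF f' g'] k[OF C.comp_hom[OF f' f] C.comp_hom[OF g g']] h ghf)
  qed
  note mk = prof_mk_functor[of C C "\<lambda>x y. vset (chom C x y)" k, folded eq,
      OF C C hom_in k_fun k_id k_comp]
  show "is_prof U C C (hom_functor C)" by (rule mk(1))
  show "x \<in> elts (Ob C) \<Longrightarrow> y \<in> elts (Ob C) \<Longrightarrow> pobj (hom_functor C) x y = vset (chom C x y)"
    by (rule mk(2))
  have "\<And>f g x x' y y' h. f \<in> chom C x' x \<Longrightarrow> g \<in> chom C y y' \<Longrightarrow>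
      pact (hom_functor C) f g h = app (k f g) h"
    by (rule mk(3))
  then show "pact (hom_functor C) f g h = ccomp C g (ccomp C h f)"
    if f: "f \<in> chom C x' x" and g: "g \<in> chom C y y'" and h: "h \<in> chom C x y"
    using f g by (simp add: k[OF f g] h)
qed

context profunctor
begin

text \<open>
  The co-Yoneda lemma. In the composite with the hom functor every class \<open>[h, \<phi>]\<close> slides to
  \<open>[id, F(h, id)(\<phi>)]\<close>, so evaluation \<open>[h, \<phi>] \<mapsto> F(h, id)(\<phi>)\<close> has the inverse \<open>\<phi> \<mapsto> [id, \<phi>]\<close>.
\<close>

lemma tensor_unit_left:
  assumes Ob: "Ob C \<in> elts U" and Arr: "Arr C \<in> elts U"
  shows "\<exists>\<theta>. prof_iso C D (tensor C C D (hom_functor C) F) F \<theta> \<and>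
    (\<forall>x y z h \<phi>. x \<in> elts (Ob C) \<longrightarrow> y \<in> elts (Ob C) \<longrightarrow> z \<in> elts (Ob D) \<longrightarrow>
      h \<in> elts (pobj (hom_functor C) x y) \<longrightarrow> \<phi> \<in> elts (pobj F y z) \<longrightarrow>
      \<theta> x z (tensor_class C C D (hom_functor C) F x z y h \<phi>) = pact F h (cid D z) \<phi>)"
proof -
  note hom = hom_prof[OF C.category Arr]
  interpret T: composable U C C D "hom_functor C" F
    by unfold_locales (rule hom(1), rule Ob)
  have hom_in: "h \<in> elts (pobj (hom_functor C) x y) \<longleftrightarrow> h \<in> chom C x y"
    if "x \<in> elts (Ob C)" "y \<in> elts (Ob C)" for h x y
    using that by (simp add: hom(2))
  show ?thesis
  proof (rule T.tensor_isoI[where j = "\<lambda>x z \<phi>. T.cls x z x (cid C x) \<phi>"])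
    fix x z assume x: "x \<in> elts (Ob C)" and z: "z \<in> elts (Ob D)"
    show "balanced C C D (hom_functor C) F x z (\<lambda>y h \<phi>. pact F h (cid D z) \<phi>)"
    proof (rule balancedI)
      fix y y' f h \<phi>
      assume f: "f \<in> chom C y y'" and h: "h \<in> elts (pobj (hom_functor C) x y)"
        and \<phi>: "\<phi> \<in> elts (pobj F y' z)"
      have h: "h \<in> chom C x y" using h x C.hom_ob[OF f] by (simp add: hom_in)
      show "pact F h (cid D z) (pact F f (cid D z) \<phi>) =
          pact F (pact (hom_functor C) (cid C x) f h) (cid D z) \<phi>"
        by (simp add: pact_comp_left[OF f h z \<phi>] hom(3)[OF C.id_hom[OF x] f h] C.comp_id[OF h])
    qed
    fix b assume b: "b \<in> elts (pobj F x z)"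
    then show "\<exists>y\<in>elts (Ob C). \<exists>h\<in>elts (pobj (hom_functor C) x y). \<exists>\<phi>\<in>elts (pobj F y z).
        b = pact F h (cid D z) \<phi>"
      using x z pact_id[OF x z b] by (intro bexI[of _ x] bexI[of _ "cid C x"] bexI[of _ b]) (simp_all add: hom_in)
  next
    fix x y z h \<phi>
    assume x: "x \<in> elts (Ob C)" and y: "y \<in> elts (Ob C)" and z: "z \<in> elts (Ob D)"
      and h: "h \<in> elts (pobj (hom_functor C) x y)" and \<phi>: "\<phi> \<in> elts (pobj F y z)"
    have h: "h \<in> chom C x y" using h x y by (simp add: hom_in)
    show "pact F h (cid D z) \<phi> \<in> elts (pobj F x z)" by (rule pact_in[OF h D.id_hom[OF z] \<phi>])
    have "pact (hom_functor C) (cid C x) h (cid C x) = h"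
      using x h by (simp add: hom(3)[OF C.id_hom[OF x] h C.id_hom[OF x]] C.comp_id[OF C.id_hom[OF x]] C.comp_id)
    then show "T.cls x z x (cid C x) (pact F h (cid D z) \<phi>) = T.cls x z y h \<phi>"
      using T.cls_slide[OF x z h _ \<phi>, of "cid C x"] x by (simp add: hom_in)
  next
    fix x x' y z z' f g h \<phi>
    assume f: "f \<in> chom C x' x" and g: "g \<in> chom D z z'" and y: "y \<in> elts (Ob C)"
      and h: "h \<in> elts (pobj (hom_functor C) x y)" and \<phi>: "\<phi> \<in> elts (pobj F y z)"
    have h: "h \<in> chom C x y" using h y C.hom_ob[OF f] by (simp add: hom_in)
    have z: "z \<in> elts (Ob D)" "z' \<in> elts (Ob D)" using D.hom_ob[OF g] by auto
    have hf: "ccomp C h f \<in> chom C x' y" by (rule C.comp_hom[OF f h])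
    have "pact F (ccomp C h f) (cid D z') (pact F (cid C y) g \<phi>) = pact F (ccomp C h f) g \<phi>"
      by (rule pact_right_left[OF hf g \<phi>])
    also have "\<dots> = pact F f g (pact F h (cid D z) \<phi>)"
      using pact_comp[OF h D.id_hom[OF z(1)] f g \<phi>] by (simp add: D.comp_id[OF g])
    finally show "pact F (pact (hom_functor C) f (cid C y) h) (cid D z') (pact F (cid C y) g \<phi>) =
        pact F f g (pact F h (cid D z) \<phi>)"
      by (simp add: hom(3)[OF f C.id_hom[OF y] h] C.id_comp[OF hf])
  qed
qed

text \<open>
  The mirror image: \<open>[\<phi>, h]\<close> slides to \<open>[F(id, h)(\<phi>), id]\<close>.
\<close>

lemma tensor_unit_right:
  assumes Ob: "Ob D \<in> elts U" and Arr: "Arr D \<in> elts U"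
  shows "\<exists>\<theta>. prof_iso C D (tensor C D D F (hom_functor D)) F \<theta> \<and>
    (\<forall>x y z \<phi> h. x \<in> elts (Ob C) \<longrightarrow> y \<in> elts (Ob D) \<longrightarrow> z \<in> elts (Ob D) \<longrightarrow>
      \<phi> \<in> elts (pobj F x y) \<longrightarrow> h \<in> elts (pobj (hom_functor D) y z) \<longrightarrow>
      \<theta> x z (tensor_class C D D F (hom_functor D) x z y \<phi> h) = pact F (cid C x) h \<phi>)"
proof -
  note hom = hom_prof[OF D.category Arr]
  interpret T: composable U C D D F "hom_functor D"
    by unfold_locales (rule hom(1), rule Ob)
  have hom_in: "h \<in> elts (pobj (hom_functor D) x y) \<longleftrightarrow> h \<in> chom D x y"
    if "x \<in> elts (Ob D)" "y \<in> elts (Ob D)" for h x y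
    using that by (simp add: hom(2))
  show ?thesis
  proof (rule T.tensor_isoI[where j = "\<lambda>x z \<phi>. T.cls x z z \<phi> (cid D z)"])
    fix x z assume x: "x \<in> elts (Ob C)" and z: "z \<in> elts (Ob D)"
    show "balanced C D D F (hom_functor D) x z (\<lambda>y \<phi> h. pact F (cid C x) h \<phi>)"
    proof (rule balancedI)
      fix y y' f \<phi> h
      assume f: "f \<in> chom D y y'" and \<phi>: "\<phi> \<in> elts (pobj F x y)"
        and h: "h \<in> elts (pobj (hom_functor D) y' z)"
      have h: "h \<in> chom D y' z" using h z D.hom_ob[OF f] by (simp add: hom_in)
      have hf: "ccomp D h f \<in> chom D y z" by (rule D.comp_hom[OF f h])
      show "pact F (cid C x) (pact (hom_functor D) f (cid D z) h) \<phi> =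
          pact F (cid C x) h (pact F (cid C x) f \<phi>)"
        by (simp add: pact_comp_right[OF f h x \<phi>] hom(3)[OF f D.id_hom[OF z] h] D.id_comp[OF hf])
    qed
    fix b assume b: "b \<in> elts (pobj F x z)"
    then show "\<exists>y\<in>elts (Ob D). \<exists>\<phi>\<in>elts (pobj F x y). \<exists>h\<in>elts (pobj (hom_functor D) y z).
        b = pact F (cid C x) h \<phi>"
      using x z pact_id[OF x z b] by (intro bexI[of _ z] bexI[of _ b] bexI[of _ "cid D z"]) (simp_all add: hom_in)
  next
    fix x y z \<phi> h
    assume x: "x \<in> elts (Ob C)" and y: "y \<in> elts (Ob D)" and z: "z \<in> elts (Ob D)"
      and \<phi>: "\<phi> \<in> elts (pobj F x y)" and h: "h \<in> elts (pobj (hom_functor D) y z)"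
    have h: "h \<in> chom D y z" using h y z by (simp add: hom_in)
    show "pact F (cid C x) h \<phi> \<in> elts (pobj F x z)" by (rule pact_in[OF C.id_hom[OF x] h \<phi>])
    have "pact (hom_functor D) h (cid D z) (cid D z) = h"
      by (simp add: hom(3)[OF h D.id_hom[OF z] D.id_hom[OF z]] D.id_comp[OF h])
    then show "T.cls x z z (pact F (cid C x) h \<phi>) (cid D z) = T.cls x z y \<phi> h"
      using T.cls_slide[OF x z h \<phi>, of "cid D z"] z by (simp add: hom_in)
  next
    fix x x' y z z' f g \<phi> h
    assume f: "f \<in> chom C x' x" and g: "g \<in> chom D z z'" and y: "y \<in> elts (Ob D)"
      and \<phi>: "\<phi> \<in> elts (pobj F x y)" and h: "h \<in> elts (pobj (hom_functor D) y z)"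
    have h: "h \<in> chom D y z" using h y D.hom_ob[OF g] by (simp add: hom_in)
    have x: "x \<in> elts (Ob C)" "x' \<in> elts (Ob C)" using C.hom_ob[OF f] by auto
    have gh: "ccomp D g h \<in> chom D y z'" by (rule D.comp_hom[OF h g])
    have "pact F (cid C x') (ccomp D g h) (pact F f (cid D y) \<phi>) = pact F f (ccomp D g h) \<phi>"
      by (rule pact_left_right[OF f gh \<phi>])
    also have "\<dots> = pact F f g (pact F (cid C x) h \<phi>)"
      using pact_comp[OF C.id_hom[OF x(1)] h f g \<phi>] by (simp add: C.id_comp[OF f])
    finally show "pact F (cid C x') (pact (hom_functor D) (cid D y) g h) (pact F f (cid D y) \<phi>) =
        pact F f g (pact F (cid C x) h \<phi>)"
      by (simp add: hom(3)[OF D.id_hom[OF y] g h] D.comp_id[OF h])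
  qed
qed

end

section \<open>The category of pointed categories and pointed profunctors\<close>

definition represents :: "'v::zfc \<Rightarrow> 'v \<Rightarrow> 'v \<Rightarrow> 'v \<Rightarrow> 'v \<Rightarrow> 'v \<Rightarrow> 'v \<Rightarrow> 'v \<Rightarrow> bool"
  where "represents U C x D y F \<phi> f \<longleftrightarrow>
    small_category U C \<and> x \<in> elts (Ob C) \<and> small_category U D \<and> y \<in> elts (Ob D) \<and>
    is_prof U C D F \<and> \<phi> \<in> elts (pobj F x y) \<and> f = Omega_arr U C x D y F \<phi>"

text \<open>
  Composition of classes goes through chosen representatives; \<open>Omega_comp_eq\<close> shows that every
  choice gives the same class.
\<close>

definition Omega_comp :: "'v::zfc \<Rightarrow> 'v \<Rightarrow> 'v \<Rightarrow> 'v"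
  where "Omega_comp U g f = (SOME h. \<exists>C x D y E z F \<phi> G \<psi>.
    represents U C x D y F \<phi> f \<and> represents U D y E z G \<psi> g \<and>
    h = Omega_arr U C x E z (tensor C D E F G) (tensor_class C D E F G x z y \<phi> \<psi>))"

definition Omega_id :: "'v::zfc \<Rightarrow> 'v \<Rightarrow> 'v"
  where "Omega_id U a =
    Omega_arr U (vfst a) (vsnd a) (vfst a) (vsnd a) (hom_functor (vfst a)) (cid (vfst a) (vsnd a))"

definition Omega :: "'v::zfc \<Rightarrow> 'v"
  where "Omega U = mk_cat
    (vset {vpair C x | C x. small_category U C \<and> x \<in> elts (Ob C)})
    (vset {f. \<exists>C x D y F \<phi>. represents U C x D y F \<phi> f})
    vfst (\<lambda>f. vfst (vsnd f)) (Omega_id U) (Omega_comp U)"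

context universe
begin

lemma small_profunctor:
  assumes "small_category U C" "small_category U D" "is_prof U C D F"
  shows "profunctor U C D F"
  using assms unfolding small_category_def by unfold_locales auto

lemma prof_elts: "small_category U C \<Longrightarrow> small_category U D \<Longrightarrow> is_prof U C D F \<Longrightarrow> F \<in> elts U"
  by (rule profunctor.prof_in[OF small_profunctor]) (auto simp: small_category_def)

lemma pointed_iso_Image_subset:
  assumes "small_category U C" "x \<in> elts (Ob C)" "small_category U D" "y \<in> elts (Ob D)"
  shows "pointed_iso U C x D y `` {p} \<subseteq> elts U"
proof
  fix q assume "q \<in> pointed_iso U C x D y `` {p}"
  then obtain G \<psi> where q: "q = vpair G \<psi>" and G: "is_prof U C D G" and \<psi>: "\<psi> \<in> elts (pobj G x y)"
    unfolding pointed_iso_def by blast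
  have "pobj G x y \<in> elts U"
    by (rule profunctor.pobj_in[OF small_profunctor[OF assms(1,3) G] assms(2,4)])
  then show "q \<in> elts U" unfolding q using prof_elts[OF assms(1,3) G] \<psi> mem_trans by (blast intro: vpair_in)
qed

text \<open>
  Equality of tagged classes is equality of the tags together with an isomorphism that matches
  the points. All laws of the category reduce to coherence isomorphisms in this way. The classes
  have to be sets here, since \<open>vset\<close> distinguishes only sets.
\<close>

lemma Omega_arr_eq_iff:
  assumes f: "represents U C x D y F \<phi> f" and g: "represents U C' x' D' y' G \<psi> g"
  shows "f = g \<longleftrightarrow> C = C' \<and> x = x' \<and> D = D' \<and> y = y' \<and> (\<exists>\<theta>. prof_iso C D F G \<theta> \<and> \<theta> x y \<phi> = \<psi>)"
proof (cases "C = C' \<and> x = x' \<and> D = D' \<and> y = y'")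
  case True
  then have eq: "C' = C" "x' = x" "D' = D" "y' = y" by simp_all
  have C: "small_category U C" "x \<in> elts (Ob C)" and D: "small_category U D" "y \<in> elts (Ob D)"
    and F: "is_prof U C D F" "\<phi> \<in> elts (pobj F x y)" and G: "is_prof U C D G" "\<psi> \<in> elts (pobj G x y)"
    using f g True by (auto simp: represents_def)
  have cat: "is_category C" "is_category D" using C D by (auto simp: small_category_def)
  have small: "small (pointed_iso U C x D y `` {p})" for p
    by (rule small_subset[OF small_elts pointed_iso_Image_subset[OF C D]])
  have "f = g \<longleftrightarrow> pointed_iso U C x D y `` {vpair F \<phi>} = pointed_iso U C x D y `` {vpair G \<psi>}"
    using f g by (simp add: eq represents_def Omega_arr_def vclass_def vset_inject[OF small small])
  also have "\<dots> \<longleftrightarrow> (vpair F \<phi>, vpair G \<psi>) \<in> pointed_iso U C x D y"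
    using F G by (intro eq_equiv_class_iff[OF equiv_pointed_iso[OF cat C(2) D(2)]]) auto
  finally show ?thesis using F G by (simp add: eq pointed_iso_iff[OF cat C(2) D(2)])
next
  case False
  then show ?thesis using f g by (auto simp: represents_def Omega_arr_def)
qed

lemma represents_composable:
  assumes "represents U C x D y F \<phi> f" and "represents U D y E z G \<psi> g"
  shows "composable U C D E F G"
proof -
  interpret F: profunctor U C D F using assms(1) small_profunctor by (simp add: represents_def)
  interpret G: profunctor U D E G using assms(2) small_profunctor by (simp add: represents_def)
  show ?thesis by unfold_locales (use assms in \<open>simp add: represents_def small_category_def\<close>)
qed

lemma represents_tensor:
  assumes "represents U C x D y F \<phi> f" and "represents U D y E z G \<psi> g"
  shows "represents U C x E z (tensor C D E F G) (tensor_class C D E F G x z y \<phi> \<psi>)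
    (Omega_arr U C x E z (tensor C D E F G) (tensor_class C D E F G x z y \<phi> \<psi>))"
  using composable.tensor_prof[OF represents_composable[OF assms]]
    composable.cls_in_pobj[OF represents_composable[OF assms]] assms
  by (simp add: represents_def)

lemma Omega_comp_eq:
  assumes f: "represents U C x D y F \<phi> f" and g: "represents U D y E z G \<psi> g"
  shows "Omega_comp U g f =
    Omega_arr U C x E z (tensor C D E F G) (tensor_class C D E F G x z y \<phi> \<psi>)"
  unfolding Omega_comp_def
proof (rule some_equality)
  show "\<exists>C' x' D' y' E' z' F' \<phi>' G' \<psi>'.
      represents U C' x' D' y' F' \<phi>' f \<and> represents U D' y' E' z' G' \<psi>' g \<and>
      Omega_arr U C x E z (tensor C D E F G) (tensor_class C D E F G x z y \<phi> \<psi>) =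
      Omega_arr U C' x' E' z' (tensor C' D' E' F' G') (tensor_class C' D' E' F' G' x' z' y' \<phi>' \<psi>')"
    using f g by blast
next
  fix h assume "\<exists>C x D y E z F \<phi> G \<psi>. represents U C x D y F \<phi> f \<and> represents U D y E z G \<psi> g \<and>
    h = Omega_arr U C x E z (tensor C D E F G) (tensor_class C D E F G x z y \<phi> \<psi>)"
  then obtain C' x' D' y' E' z' F' \<phi>' G' \<psi>' where
    f': "represents U C' x' D' y' F' \<phi>' f" and g': "represents U D' y' E' z' G' \<psi>' g"
    and h: "h = Omega_arr U C' x' E' z' (tensor C' D' E' F' G') (tensor_class C' D' E' F' G' x' z' y' \<phi>' \<psi>')"
    by blast
  obtain \<alpha> where eq [simp]: "C' = C" "x' = x" "D' = D" "y' = y"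
    and \<alpha>: "prof_iso C D F F' \<alpha>" "\<alpha> x y \<phi> = \<phi>'"
    using Omega_arr_eq_iff[OF f f'] by auto
  obtain \<beta> where eq' [simp]: "E' = E" "z' = z" and \<beta>: "prof_iso D E G G' \<beta>" "\<beta> y z \<psi> = \<psi>'"
    using Omega_arr_eq_iff[OF g g'] by auto
  note f' = f'[unfolded eq] and g' = g'[unfolded eq eq']
  obtain \<theta> where "prof_iso C E (tensor C D E F G) (tensor C D E F' G') \<theta>"
    and "\<theta> x z (tensor_class C D E F G x z y \<phi> \<psi>) = tensor_class C D E F' G' x z y \<phi>' \<psi>'"
    using tensor_cong[OF represents_composable[OF f g] represents_composable[OF f' g'] \<alpha>(1) \<beta>(1)]
      f g \<alpha>(2) \<beta>(2) by (auto simp: represents_def)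
  then show "h = Omega_arr U C x E z (tensor C D E F G) (tensor_class C D E F G x z y \<phi> \<psi>)"
    unfolding h
    using Omega_arr_eq_iff[OF represents_tensor[OF f g] represents_tensor[OF f' g']] by auto
qed

lemma represents_comp:
  assumes "represents U C x D y F \<phi> f" and "represents U D y E z G \<psi> g"
  shows "represents U C x E z (tensor C D E F G) (tensor_class C D E F G x z y \<phi> \<psi>) (Omega_comp U g f)"
  using represents_tensor[OF assms] by (simp add: Omega_comp_eq[OF assms])

lemma represents_id:
  assumes "small_category U C" "x \<in> elts (Ob C)"
  shows "represents U C x C x (hom_functor C) (cid C x) (Omega_id U (vpair C x))"
proof -
  interpret C: category C by unfold_locales (use assms in \<open>simp add: small_category_def\<close>)
  show ?thesis
    using assms hom_prof[OF C.category] by (simp add: represents_def Omega_id_def small_category_def)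
qed

lemma Omega_comp_id:
  assumes f: "represents U C x D y F \<phi> f"
  shows "Omega_comp U f (Omega_id U (vpair C x)) = f"
proof -
  have C: "small_category U C" "x \<in> elts (Ob C)" and D: "small_category U D" "y \<in> elts (Ob D)"
    and F: "is_prof U C D F" and \<phi>: "\<phi> \<in> elts (pobj F x y)" using f by (auto simp: represents_def)
  interpret profunctor U C D F by (rule small_profunctor[OF C(1) D(1) F])
  note id = represents_id[OF C]
  obtain \<theta> where "prof_iso C D (tensor C C D (hom_functor C) F) F \<theta>"
    and "\<theta> x y (tensor_class C C D (hom_functor C) F x y x (cid C x) \<phi>) = pact F (cid C x) (cid D y) \<phi>"
    using tensor_unit_left C D \<phi> id by (auto simp: small_category_def represents_def)
  then show ?thesis
    using Omega_arr_eq_iff[OF represents_comp[OF id f] f] C(2) D(2) \<phi> pact_id by auto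
qed

lemma Omega_id_comp:
  assumes f: "represents U C x D y F \<phi> f"
  shows "Omega_comp U (Omega_id U (vpair D y)) f = f"
proof -
  have C: "small_category U C" "x \<in> elts (Ob C)" and D: "small_category U D" "y \<in> elts (Ob D)"
    and F: "is_prof U C D F" and \<phi>: "\<phi> \<in> elts (pobj F x y)" using f by (auto simp: represents_def)
  interpret profunctor U C D F by (rule small_profunctor[OF C(1) D(1) F])
  note id = represents_id[OF D]
  obtain \<theta> where "prof_iso C D (tensor C D D F (hom_functor D)) F \<theta>"
    and "\<theta> x y (tensor_class C D D F (hom_functor D) x y y \<phi> (cid D y)) = pact F (cid C x) (cid D y) \<phi>"
    using tensor_unit_right C D \<phi> id by (auto simp: small_category_def represents_def)
  then show ?thesis
    using Omega_arr_eq_iff[OF represents_comp[OF f id] f] C(2) D(2) \<phi> pact_id by auto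
qed

lemma Omega_comp_assoc:
  assumes f: "represents U B w C x F \<phi> f" and g: "represents U C x D y G \<psi> g"
    and h: "represents U D y E z H \<chi> h"
  shows "Omega_comp U h (Omega_comp U g f) = Omega_comp U (Omega_comp U h g) f"
proof -
  obtain \<theta> where "prof_iso B E (tensor B D E (tensor B C D F G) H) (tensor B C E F (tensor C D E G H)) \<theta>"
    and "\<theta> w z (tensor_class B D E (tensor B C D F G) H w z y (tensor_class B C D F G w y x \<phi> \<psi>) \<chi>) =
        tensor_class B C E F (tensor C D E G H) w z x \<phi> (tensor_class C D E G H x z y \<psi> \<chi>)"
    using tensor_assoc[OF represents_composable[OF f g] represents_composable[OF g h]] f g h
    by (auto simp: represents_def)
  then show ?thesis
    using Omega_arr_eq_iff[OF represents_comp[OF represents_comp[OF f g] h]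
        represents_comp[OF f represents_comp[OF g h]]] by blast
qed

lemma pointed_category_in:
  assumes "small_category U C" "x \<in> elts (Ob C)"
  shows "vpair C x \<in> elts U"
proof -
  interpret C: category C by unfold_locales (use assms in \<open>simp add: small_category_def\<close>)
  have Ob: "Ob C \<in> elts U" and Arr: "Arr C \<in> elts U" using assms by (auto simp: small_category_def)
  have "{vpair g f | g f. g \<in> elts (Arr C) \<and> f \<in> elts (Arr C) \<and> cdom C g = ccod C f}
      \<subseteq> elts (vtimes (Arr C) (Arr C))" by (auto simp: elts_vtimes)
  then have comp: "vset {vpair g f | g f. g \<in> elts (Arr C) \<and> f \<in> elts (Arr C) \<and> cdom C g = ccod C f} \<in> elts U"
    by (rule vset_subset_in[OF vtimes_in[OF Arr Arr]])
  have arr: "cdom C f \<in> elts (Ob C)" "ccod C f \<in> elts (Ob C)" if "f \<in> elts (Arr C)" for f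
    using C.hom_ob[of f "cdom C f" "ccod C f"] that by (auto intro: chomI)
  have id: "cid C a \<in> elts (Arr C)" if "a \<in> elts (Ob C)" for a
    using chomD[OF C.id_hom[OF that]] by simp
  have m: "ccomp C g f \<in> elts (Arr C)"
    if "g \<in> elts (Arr C)" "f \<in> elts (Arr C)" "cdom C g = ccod C f" for g f
    using chomD[OF C.comp_hom[OF chomI chomI]] that by metis
  have "mk_cat (Ob C) (Arr C) (cdom C) (ccod C) (cid C) (ccomp C) \<in> elts U"
    unfolding mk_cat_def
    by (intro vpair_in vlambda_in Ob Arr comp)
       (auto simp: elts_composable intro: mem_trans[OF Ob arr(1)] mem_trans[OF Ob arr(2)]
          mem_trans[OF Arr id] mem_trans[OF Arr m])
  moreover have "C = mk_cat (Ob C) (Arr C) (cdom C) (ccod C) (cid C) (ccomp C)"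
    using C.category unfolding is_category_def by blast
  ultimately have "C \<in> elts U" by simp
  then show ?thesis using assms(2) Ob mem_trans by (blast intro: vpair_in)
qed

text \<open>
  A bound for the set of all arrows: the tags are elements of \<open>U\<close> and the class is a subset
  of \<open>U\<close>. Hence the arrows form a set, and this set belongs to any universe that contains \<open>U\<close>.
\<close>

lemma represents_in:
  assumes "represents U C x D y F \<phi> f"
  shows "f \<in> elts (vtimes U (vtimes U (vset {z. elts z \<subseteq> elts U})))"
proof -
  have C: "small_category U C" "x \<in> elts (Ob C)" and D: "small_category U D" "y \<in> elts (Ob D)"
    using assms by (auto simp: represents_def)
  note sub = pointed_iso_Image_subset[OF C D, of "vpair F \<phi>"]
  have "elts (vclass (pointed_iso U C x D y) (vpair F \<phi>)) \<subseteq> elts U"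
    using sub elts_vset[OF small_subset[OF small_elts sub]] by (simp add: vclass_def)
  then show ?thesis using assms pointed_category_in[OF C] pointed_category_in[OF D]
    by (simp add: represents_def Omega_arr_def elts_vtimes elts_vset small_Pow)
qed

lemma elts_Ob_Omega: "elts (Ob (Omega U)) = {vpair C x | C x. small_category U C \<and> x \<in> elts (Ob C)}"
proof -
  have "{vpair C x | C x. small_category U C \<and> x \<in> elts (Ob C)} \<subseteq> elts U"
    using pointed_category_in by blast
  then show ?thesis unfolding Omega_def Ob_mk_cat by (rule elts_vset[OF small_subset[OF small_elts]])
qed

lemma elts_Arr_Omega: "elts (Arr (Omega U)) = {f. \<exists>C x D y F \<phi>. represents U C x D y F \<phi> f}"
proof -
  have "{f. \<exists>C x D y F \<phi>. represents U C x D y F \<phi> f}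
      \<subseteq> elts (vtimes U (vtimes U (vset {z. elts z \<subseteq> elts U})))"
    using represents_in by blast
  then show ?thesis unfolding Omega_def Arr_mk_cat by (rule elts_vset[OF small_subset[OF small_elts]])
qed

lemma Omega_ops:
  "f \<in> elts (Arr (Omega U)) \<Longrightarrow> cdom (Omega U) f = vfst f"
  "f \<in> elts (Arr (Omega U)) \<Longrightarrow> ccod (Omega U) f = vfst (vsnd f)"
  "a \<in> elts (Ob (Omega U)) \<Longrightarrow> cid (Omega U) a = Omega_id U a"
  "g \<in> elts (Arr (Omega U)) \<Longrightarrow> f \<in> elts (Arr (Omega U)) \<Longrightarrow> vfst g = vfst (vsnd f) \<Longrightarrow>
    ccomp (Omega U) g f = Omega_comp U g f"
  by (simp_all add: Omega_def)

lemma chom_Omega: "f \<in> chom (Omega U) a b \<longleftrightarrow>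
    (\<exists>C x D y F \<phi>. a = vpair C x \<and> b = vpair D y \<and> represents U C x D y F \<phi> f)"
proof -
  have "f \<in> chom (Omega U) a b \<longleftrightarrow> f \<in> elts (Arr (Omega U)) \<and> vfst f = a \<and> vfst (vsnd f) = b"
    using Omega_ops(1,2) unfolding chom_def by auto
  moreover have "vfst f = vpair C x" "vfst (vsnd f) = vpair D y" if "represents U C x D y F \<phi> f" for C x D y F \<phi>
    using that by (simp_all add: represents_def Omega_arr_def)
  ultimately show ?thesis unfolding elts_Arr_Omega by blast
qed

lemma ccomp_Omega:
  assumes f: "represents U C x D y F \<phi> f" and g: "represents U D y E z G \<psi> g"
  shows "ccomp (Omega U) g f = Omega_comp U g f"
proof (rule Omega_ops(4))
  show "g \<in> elts (Arr (Omega U))" "f \<in> elts (Arr (Omega U))" using f g elts_Arr_Omega by blast+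
  show "vfst g = vfst (vsnd f)" using f g by (simp add: represents_def Omega_arr_def)
qed

lemma cid_Omega: "small_category U C \<Longrightarrow> x \<in> elts (Ob C) \<Longrightarrow>
    cid (Omega U) (vpair C x) = Omega_id U (vpair C x)"
  by (intro Omega_ops(3)) (auto simp: elts_Ob_Omega)

lemma category_Omega: "is_category (Omega U)"
  unfolding is_category_def
proof (intro conjI ballI allI impI)
  show "Omega U = mk_cat (Ob (Omega U)) (Arr (Omega U)) (cdom (Omega U)) (ccod (Omega U))
      (cid (Omega U)) (ccomp (Omega U))"
  proof -
    have "Omega U = mk_cat (Ob (Omega U)) (Arr (Omega U)) vfst (\<lambda>f. vfst (vsnd f)) (Omega_id U) (Omega_comp U)"
      by (simp add: Omega_def)
    also have "\<dots> = mk_cat (Ob (Omega U)) (Arr (Omega U)) (cdom (Omega U)) (ccod (Omega U))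
        (cid (Omega U)) (ccomp (Omega U))"
      by (rule mk_cat_cong) (simp_all add: Omega_ops)
    finally show ?thesis .
  qed
next
  fix f assume "f \<in> elts (Arr (Omega U))"
  then obtain C x D y F \<phi> where f: "represents U C x D y F \<phi> f" unfolding elts_Arr_Omega by blast
  then have "f \<in> chom (Omega U) (vpair C x) (vpair D y)" unfolding chom_Omega by blast
  then have "cdom (Omega U) f = vpair C x" "ccod (Omega U) f = vpair D y" by (auto simp: chom_def)
  then show "cdom (Omega U) f \<in> elts (Ob (Omega U))" "ccod (Omega U) f \<in> elts (Ob (Omega U))"
    using f by (auto simp: elts_Ob_Omega represents_def)
next
  fix a assume "a \<in> elts (Ob (Omega U))"
  then obtain C x where a: "a = vpair C x" and C: "small_category U C" "x \<in> elts (Ob C)"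
    unfolding elts_Ob_Omega by blast
  show "cid (Omega U) a \<in> chom (Omega U) a a"
    unfolding a cid_Omega[OF C] chom_Omega using represents_id[OF C] by blast
next
  fix a b c f g assume "f \<in> chom (Omega U) a b" "g \<in> chom (Omega U) b c"
  then obtain C x D y E z F \<phi> G \<psi> where ac: "a = vpair C x" "c = vpair E z"
    and f: "represents U C x D y F \<phi> f" and g: "represents U D y E z G \<psi> g"
    unfolding chom_Omega by auto
  show "ccomp (Omega U) g f \<in> chom (Omega U) a c"
    unfolding ccomp_Omega[OF f g] chom_Omega using represents_comp[OF f g] ac by blast
next
  fix a b f assume "f \<in> chom (Omega U) a b"
  then obtain C x D y F \<phi> where ab: "a = vpair C x" "b = vpair D y"
    and f: "represents U C x D y F \<phi> f" unfolding chom_Omega by blast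
  have C: "small_category U C" "x \<in> elts (Ob C)" and D: "small_category U D" "y \<in> elts (Ob D)"
    using f by (auto simp: represents_def)
  show "ccomp (Omega U) f (cid (Omega U) a) = f"
    by (simp add: ab cid_Omega[OF C] ccomp_Omega[OF represents_id[OF C] f] Omega_comp_id[OF f])
  show "ccomp (Omega U) (cid (Omega U) b) f = f"
    by (simp add: ab cid_Omega[OF D] ccomp_Omega[OF f represents_id[OF D]] Omega_id_comp[OF f])
next
  fix a b c d f g h
  assume "f \<in> chom (Omega U) a b" "g \<in> chom (Omega U) b c" "h \<in> chom (Omega U) c d"
  then obtain B w C x D y E z F \<phi> G \<psi> H \<chi> where f: "represents U B w C x F \<phi> f"
    and g: "represents U C x D y G \<psi> g" and h: "represents U D y E z H \<chi> h"
    unfolding chom_Omega by auto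
  show "ccomp (Omega U) h (ccomp (Omega U) g f) = ccomp (Omega U) (ccomp (Omega U) h g) f"
    by (simp add: ccomp_Omega[OF f g] ccomp_Omega[OF g h] ccomp_Omega[OF represents_comp[OF f g] h]
        ccomp_Omega[OF f represents_comp[OF g h]] Omega_comp_assoc[OF f g h])
qed

lemma small_category_Omega:
  assumes "grothendieck_universe U'" and U: "U \<in> elts U'"
  shows "small_category U' (Omega U)"
proof -
  interpret U': universe U' by unfold_locales fact
  have "elts (Ob (Omega U)) \<subseteq> elts U" unfolding elts_Ob_Omega using pointed_category_in by blast
  then have "Ob (Omega U) \<in> elts U'" by (rule U'.subset_in[OF U])
  moreover have "vtimes U (vtimes U (vset {z. elts z \<subseteq> elts U})) \<in> elts U'"
    by (intro U'.vtimes_in U'.Pow_in U)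
  then have "Arr (Omega U) \<in> elts U'"
    by (rule U'.subset_in) (use represents_in elts_Arr_Omega in blast)
  ultimately show ?thesis unfolding small_category_def using category_Omega by blast
qed

end

text \<open>
  Every arrow lies in the hom set between its own domain and codomain, so the hom sets determine
  the set of arrows and the domain and codomain functions; the tuple that codes a category has no
  other freedom than the identities and the composites of composable pairs.
\<close>

lemma category_eqI:
  assumes "is_category A" "is_category B" and Ob: "Ob A = Ob B"
    and hom: "\<And>a b. a \<in> elts (Ob A) \<Longrightarrow> b \<in> elts (Ob A) \<Longrightarrow> chom A a b = chom B a b"
    and id: "\<And>a. a \<in> elts (Ob A) \<Longrightarrow> cid A a = cid B a"
    and comp: "\<And>a b c f g. f \<in> chom A a b \<Longrightarrow> g \<in> chom A b c \<Longrightarrow> ccomp A g f = ccomp B g f"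
  shows "A = B"
proof -
  interpret A: category A by unfold_locales fact
  interpret B: category B by unfold_locales fact
  have hom': "chom A a b = chom B a b" for a b
    using hom[of a b] A.hom_ob[of _ a b] B.hom_ob[of _ a b] Ob by auto
  have mem: "f \<in> elts (Arr A) \<longleftrightarrow> f \<in> elts (Arr B)"
    and dom: "f \<in> elts (Arr A) \<Longrightarrow> cdom A f = cdom B f"
    and cod: "f \<in> elts (Arr A) \<Longrightarrow> ccod A f = ccod B f" for f
    using hom'[of "cdom A f" "ccod A f"] hom'[of "cdom B f" "ccod B f"] unfolding chom_def by auto
  have Arr: "Arr A = Arr B" by (rule extensionality) (use mem in blast)
  have "mk_cat (Ob A) (Arr A) (cdom A) (ccod A) (cid A) (ccomp A) =
      mk_cat (Ob A) (Arr A) (cdom B) (ccod B) (cid B) (ccomp B)"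
    by (rule mk_cat_cong) (auto simp: dom[symmetric] cod[symmetric] id intro: dom cod comp chomI)
  then show ?thesis
    using A.category B.category Ob Arr unfolding is_category_def by metis
qed

section \<open>Existence and uniqueness\<close>

theorem mainTheorem1:
  fixes U U' :: "'v::zfc"
  assumes "grothendieck_universe U" and "grothendieck_universe U'" and "U \<in> elts U'"
  shows "\<exists>!\<Omega>. small_category U' \<Omega> \<and>
    elts (Ob \<Omega>) = {vpair C x | C x. small_category U C \<and> x \<in> elts (Ob C)} \<and>
    (\<forall>C x D y. small_category U C \<longrightarrow> x \<in> elts (Ob C) \<longrightarrow>
       small_category U D \<longrightarrow> y \<in> elts (Ob D) \<longrightarrow>
       chom \<Omega> (vpair C x) (vpair D y) =
         {Omega_arr U C x D y F \<phi> | F \<phi>. is_prof U C D F \<and> \<phi> \<in> elts (pobj F x y)}) \<and>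
    (\<forall>C x D y E z F \<phi> G \<psi>. small_category U C \<longrightarrow> x \<in> elts (Ob C) \<longrightarrow>
       small_category U D \<longrightarrow> y \<in> elts (Ob D) \<longrightarrow>
       small_category U E \<longrightarrow> z \<in> elts (Ob E) \<longrightarrow>
       is_prof U C D F \<longrightarrow> \<phi> \<in> elts (pobj F x y) \<longrightarrow>
       is_prof U D E G \<longrightarrow> \<psi> \<in> elts (pobj G y z) \<longrightarrow>
       ccomp \<Omega> (Omega_arr U D y E z G \<psi>) (Omega_arr U C x D y F \<phi>) =
         Omega_arr U C x E z (tensor C D E F G) (tensor_class C D E F G x z y \<phi> \<psi>)) \<and>
    (\<forall>C x. small_category U C \<longrightarrow> x \<in> elts (Ob C) \<longrightarrow>
       cid \<Omega> (vpair C x) = Omega_arr U C x C x (hom_functor C) (cid C x))"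
proof (rule ex_ex1I)
  interpret universe U by unfold_locales (rule assms(1))
  let ?P = "\<lambda>\<Omega>. small_category U' \<Omega> \<and>
    elts (Ob \<Omega>) = {vpair C x | C x. small_category U C \<and> x \<in> elts (Ob C)} \<and>
    (\<forall>C x D y. small_category U C \<longrightarrow> x \<in> elts (Ob C) \<longrightarrow>
       small_category U D \<longrightarrow> y \<in> elts (Ob D) \<longrightarrow>
       chom \<Omega> (vpair C x) (vpair D y) =
         {Omega_arr U C x D y F \<phi> | F \<phi>. is_prof U C D F \<and> \<phi> \<in> elts (pobj F x y)}) \<and>
    (\<forall>C x D y E z F \<phi> G \<psi>. small_category U C \<longrightarrow> x \<in> elts (Ob C) \<longrightarrow>
       small_category U D \<longrightarrow> y \<in> elts (Ob D) \<longrightarrow>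
       small_category U E \<longrightarrow> z \<in> elts (Ob E) \<longrightarrow>
       is_prof U C D F \<longrightarrow> \<phi> \<in> elts (pobj F x y) \<longrightarrow>
       is_prof U D E G \<longrightarrow> \<psi> \<in> elts (pobj G y z) \<longrightarrow>
       ccomp \<Omega> (Omega_arr U D y E z G \<psi>) (Omega_arr U C x D y F \<phi>) =
         Omega_arr U C x E z (tensor C D E F G) (tensor_class C D E F G x z y \<phi> \<psi>)) \<and>
    (\<forall>C x. small_category U C \<longrightarrow> x \<in> elts (Ob C) \<longrightarrow>
       cid \<Omega> (vpair C x) = Omega_arr U C x C x (hom_functor C) (cid C x))"
  show "\<exists>\<Omega>. ?P \<Omega>"
  proof (intro exI[of _ "Omega U"] conjI allI impI)
    show "small_category U' (Omega U)" by (rule small_category_Omega[OF assms(2,3)])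
    show "elts (Ob (Omega U)) = {vpair C x | C x. small_category U C \<and> x \<in> elts (Ob C)}"
      by (rule elts_Ob_Omega)
  next
    fix C x D y assume "small_category U C" "x \<in> elts (Ob C)" "small_category U D" "y \<in> elts (Ob D)"
    then show "chom (Omega U) (vpair C x) (vpair D y) =
        {Omega_arr U C x D y F \<phi> | F \<phi>. is_prof U C D F \<and> \<phi> \<in> elts (pobj F x y)}"
      unfolding set_eq_iff mem_Collect_eq chom_Omega represents_def vpair_inject by blast
  next
    fix C x D y E z F \<phi> G \<psi>
    assume "small_category U C" "x \<in> elts (Ob C)" "small_category U D" "y \<in> elts (Ob D)"
      "small_category U E" "z \<in> elts (Ob E)"
      "is_prof U C D F" "\<phi> \<in> elts (pobj F x y)" "is_prof U D E G" "\<psi> \<in> elts (pobj G y z)"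
    then have f: "represents U C x D y F \<phi> (Omega_arr U C x D y F \<phi>)"
      and g: "represents U D y E z G \<psi> (Omega_arr U D y E z G \<psi>)"
      by (simp_all add: represents_def)
    show "ccomp (Omega U) (Omega_arr U D y E z G \<psi>) (Omega_arr U C x D y F \<phi>) =
        Omega_arr U C x E z (tensor C D E F G) (tensor_class C D E F G x z y \<phi> \<psi>)"
      unfolding ccomp_Omega[OF f g] by (rule Omega_comp_eq[OF f g])
  next
    fix C x assume "small_category U C" "x \<in> elts (Ob C)"
    then show "cid (Omega U) (vpair C x) = Omega_arr U C x C x (hom_functor C) (cid C x)"
      by (simp add: cid_Omega Omega_id_def)
  qed
  fix A B assume A: "?P A" and B: "?P B"
  have Ob_A: "elts (Ob A) = {vpair C x | C x. small_category U C \<and> x \<in> elts (Ob C)}"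
    and Ob_B: "elts (Ob B) = {vpair C x | C x. small_category U C \<and> x \<in> elts (Ob C)}"
    using A B by simp_all
  have hom_A: "chom A (vpair C x) (vpair D y) =
      {Omega_arr U C x D y F \<phi> | F \<phi>. is_prof U C D F \<and> \<phi> \<in> elts (pobj F x y)}"
    and hom_B: "chom B (vpair C x) (vpair D y) =
      {Omega_arr U C x D y F \<phi> | F \<phi>. is_prof U C D F \<and> \<phi> \<in> elts (pobj F x y)}"
    if "small_category U C" "x \<in> elts (Ob C)" "small_category U D" "y \<in> elts (Ob D)" for C x D y
    using A B that by simp_all
  show "A = B"
  proof (rule category_eqI)
    show cat: "is_category A" "is_category B" using A B by (simp_all add: small_category_def)
    interpret A: category A by unfold_locales (rule cat)
    show "Ob A = Ob B" by (rule extensionality) (simp only: Ob_A Ob_B)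
    show "chom A a b = chom B a b" if "a \<in> elts (Ob A)" "b \<in> elts (Ob A)" for a b
      using that hom_A hom_B unfolding Ob_A by auto
    show "cid A a = cid B a" if a: "a \<in> elts (Ob A)" for a
    proof -
      obtain C x where "a = vpair C x" "small_category U C" "x \<in> elts (Ob C)"
        using a unfolding Ob_A by blast
      then show ?thesis using A B by simp
    qed
    show "ccomp A g f = ccomp B g f" if f: "f \<in> chom A a b" and g: "g \<in> chom A b c" for a b c f g
    proof -
      obtain C x D y E z where ob: "a = vpair C x" "b = vpair D y" "c = vpair E z"
        and C: "small_category U C" "x \<in> elts (Ob C)" and D: "small_category U D" "y \<in> elts (Ob D)"
        and E: "small_category U E" "z \<in> elts (Ob E)"
        using A.hom_ob[OF f] A.hom_ob[OF g] unfolding Ob_A by blast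
      obtain F \<phi> where F: "f = Omega_arr U C x D y F \<phi>" "is_prof U C D F" "\<phi> \<in> elts (pobj F x y)"
        using f unfolding ob hom_A[OF C D] by blast
      obtain G \<psi> where G: "g = Omega_arr U D y E z G \<psi>" "is_prof U D E G" "\<psi> \<in> elts (pobj G y z)"
        using g unfolding ob hom_A[OF D E] by blast
      show ?thesis using A B C D E F G by simp
    qed
  qed
qed

end
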